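(* Let $X,Y$ be Polish spaces, $\mu\in\mathcal P(X)$, $\nu\in\mathcal P(Y)$, and let $C:X\times Y\to\mathbb R$ be continuous, bounded from below, and integrable with respect to $\mu\otimes\nu$. Let $\bar\pi\in\Pi(\mu,\nu)$. With $\pi_\varepsilon$, $\Omega(\mu,\nu\mid C)$, $\mathcal V$, $\mathcal V_{\bar\pi,r}$ and $\mathcal V^{\mathrm{out}}_{\bar\pi,r}$ as defined in the context: (i) $\bar\pi\in\Omega(\mu,\nu\mid C)$ if and only if, for every $r>0$, $$\liminf_{\varepsilon\downarrow0}\frac{\mathcal V_{\bar\pi,r}(\varepsilon)-\mathcal V(\varepsilon)}{\varepsilon}=0.$$ (ii) $\pi_\varepsilon$ converges weakly to $\bar\pi$ as $\varepsilon\downarrow0$ if and only if, for every $r>0$, $$\liminf_{\varepsilon\downarrow0}\frac{\mathcal V^{\mathrm{out}}_{\bar\pi,r}(\varepsilon)-\mathcal V(\varepsilon)}{\varepsilon}>0.$$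
   Context: $\Pi(\mu,\nu)$ is the set of couplings of $\mu$ and $\nu$. $\mathrm{KL}(P\|M)=\int\log(dP/dM)\,dP$ if $P\ll M$, $+\infty$ otherwise. For $\pi\in\Pi(\mu,\nu)$: $J(\pi)=\int C\,d\pi\in(-\infty,+\infty]$, $\mathcal H(\pi)=\mathrm{KL}(\pi\|\mu\otimes\nu)$, $C_0=\inf_{\Pi(\mu,\nu)}J\in\mathbb R$, $\Delta(\pi)=J(\pi)-C_0\in[0,\infty]$, $F_\varepsilon(\pi)=J(\pi)+\varepsilon\mathcal H(\pi)$. For each $\varepsilon>0$, $\pi_\varepsilon$ is the unique minimiser of $F_\varepsilon$ over $\Pi(\mu,\nu)$. $\Omega(\mu,\nu\mid C)$ is the set of $\pi\in\Pi(\mu,\nu)$ such that $\pi_{\varepsilon_k}\to\pi$ weakly for some sequence $\varepsilon_k\downarrow0$. Let $S=X\times Y$ and fix a complete metric $\varrho$ on $S$ generating its topology with $0\le\varrho\le1$. The bounded-Lipschitz metric on $\mathcal P(S)$ is $$d_{\mathrm{BL}}(P,Q)=\sup\Bigl\{\Bigl|\int_S f\,d(P-Q)\Bigr|: f\in C_b(S),\ \|f\|_\infty\le1,\ \mathrm{Lip}_\varrho(f)\le1\Bigr\},$$ where $\mathrm{Lip}_\varrho(f)=\sup_{z\ne z'}|f(z)-f(z')|/\varrho(z,z')$. For $\varepsilon>0$, $r>0$: $$\mathcal V(\varepsilon)=\inf_{\pi\in\Pi(\mu,\nu)}(\Delta(\pi)+\varepsilon\mathcal H(\pi))=F_\varepsilon(\pi_\varepsilon)-C_0,$$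 $$\mathcal V_{\bar\pi,r}(\varepsilon)=\inf\{\Delta(\pi)+\varepsilon\mathcal H(\pi):\pi\in\Pi(\mu,\nu),\ d_{\mathrm{BL}}(\pi,\bar\pi)\le r\}\in[0,\infty],$$ $$\mathcal V^{\mathrm{out}}_{\bar\pi,r}(\varepsilon)=\inf\{\Delta(\pi)+\varepsilon\mathcal H(\pi):\pi\in\Pi(\mu,\nu),\ d_{\mathrm{BL}}(\pi,\bar\pi)\ge r\},$$ with $\inf\varnothing=+\infty$. *)

theory Defs
  imports "HOL-Probability.Probability" "HOL-Analysis.Bounded_Continuous_Function"
begin

text \<open>
  Integral with values in the extended reals, as the difference of the integrals of the positive
  and negative parts. It is the usual integral in \<open>(-\<infinity>, \<infinity>]\<close> as soon as the
  negative part of the integrand has finite integral, which holds in both uses below: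
  for a cost bounded from below, and for the log-density under the measure with that density
  (because \<open>t * ln t\<close> is bounded from below).
\<close>
definition ext_integral :: "'s measure \<Rightarrow> ('s \<Rightarrow> real) \<Rightarrow> ereal" where
  "ext_integral M f =
     enn2ereal (\<integral>\<^sup>+z. ennreal (f z) \<partial>M) - enn2ereal (\<integral>\<^sup>+z. ennreal (- f z) \<partial>M)"

text \<open>
  The library's \<open>KL_divergence\<close> is real-valued, hence \<open>0\<close> when the log-density is not
  integrable, and it does not treat the case without absolute continuity.
\<close>
definition KL :: "'s measure \<Rightarrow> 's measure \<Rightarrow> ereal" where
  "KL P M = (if absolutely_continuous M P
             then ext_integral P (\<lambda>z. ln (enn2real (RN_deriv M P z))) else \<infinity>)"

definition couplings ::
    "'a::topological_space measure \<Rightarrow> 'b::topological_space measure \<Rightarrow> ('a \<times> 'b) measure set" where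
  "couplings \<mu> \<nu> = {\<pi>. prob_space \<pi> \<and> sets \<pi> = sets borel \<and>
                       distr \<pi> borel fst = \<mu> \<and> distr \<pi> borel snd = \<nu>}"

definition weak_conv_at ::
    "('i \<Rightarrow> 's::topological_space measure) \<Rightarrow> 's measure \<Rightarrow> 'i filter \<Rightarrow> bool" where
  "weak_conv_at P Q F \<longleftrightarrow>
     (\<forall>f :: 's \<Rightarrow>\<^sub>C real. ((\<lambda>i. \<integral>z. apply_bcontfun f z \<partial>P i) \<longlongrightarrow> (\<integral>z. apply_bcontfun f z \<partial>Q)) F)"

definition Lip :: "('s \<Rightarrow> 's \<Rightarrow> real) \<Rightarrow> ('s \<Rightarrow> real) \<Rightarrow> ennreal" where
  "Lip \<rho> f = (SUP (z, z') \<in> {(z, z'). z \<noteq> z'}. ennreal (\<bar>f z - f z'\<bar> / \<rho> z z'))"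

text \<open>
  The norm on bounded continuous functions is the supremum norm. For probability measures the
  real supremum is over a nonempty set bounded by \<open>2\<close>.
\<close>
definition d_BL ::
    "('s::topological_space \<Rightarrow> 's \<Rightarrow> real) \<Rightarrow> 's measure \<Rightarrow> 's measure \<Rightarrow> real" where
  "d_BL \<rho> P Q = (SUP f \<in> {f :: 's \<Rightarrow>\<^sub>C real. norm f \<le> 1 \<and> Lip \<rho> (apply_bcontfun f) \<le> 1}.
                   \<bar>(\<integral>z. apply_bcontfun f z \<partial>P) - (\<integral>z. apply_bcontfun f z \<partial>Q)\<bar>)"

definition transport_cost :: "('s \<Rightarrow> real) \<Rightarrow> 's measure \<Rightarrow> ereal" where
  "transport_cost C \<pi> = ext_integral \<pi> C"

definition coupling_entropy ::
    "'a measure \<Rightarrow> 'b measure \<Rightarrow> ('a \<times> 'b) measure \<Rightarrow> ereal" where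
  "coupling_entropy \<mu> \<nu> \<pi> = KL \<pi> (\<mu> \<Otimes>\<^sub>M \<nu>)"

definition optimal_cost ::
    "'a::topological_space measure \<Rightarrow> 'b::topological_space measure \<Rightarrow> ('a \<times> 'b \<Rightarrow> real) \<Rightarrow> ereal" where
  "optimal_cost \<mu> \<nu> C = (INF \<pi> \<in> couplings \<mu> \<nu>. transport_cost C \<pi>)"

definition cost_gap ::
    "'a::topological_space measure \<Rightarrow> 'b::topological_space measure \<Rightarrow> ('a \<times> 'b \<Rightarrow> real) \<Rightarrow>
     ('a \<times> 'b) measure \<Rightarrow> ereal" where
  "cost_gap \<mu> \<nu> C \<pi> = transport_cost C \<pi> - optimal_cost \<mu> \<nu> C"

definition entropic_cost ::
    "'a measure \<Rightarrow> 'b measure \<Rightarrow> ('a \<times> 'b \<Rightarrow> real) \<Rightarrow> real \<Rightarrow> ('a \<times> 'b) measure \<Rightarrow> ereal" where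
  "entropic_cost \<mu> \<nu> C \<epsilon> \<pi> = transport_cost C \<pi> + ereal \<epsilon> * coupling_entropy \<mu> \<nu> \<pi>"

definition entropic_plan ::
    "'a::topological_space measure \<Rightarrow> 'b::topological_space measure \<Rightarrow> ('a \<times> 'b \<Rightarrow> real) \<Rightarrow>
     real \<Rightarrow> ('a \<times> 'b) measure" where
  "entropic_plan \<mu> \<nu> C \<epsilon> =
     (THE \<pi>. is_arg_min (entropic_cost \<mu> \<nu> C \<epsilon>) (\<lambda>\<pi>. \<pi> \<in> couplings \<mu> \<nu>) \<pi>)"

definition entropic_limits ::
    "'a::topological_space measure \<Rightarrow> 'b::topological_space measure \<Rightarrow> ('a \<times> 'b \<Rightarrow> real) \<Rightarrow>
     ('a \<times> 'b) measure set" where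
  "entropic_limits \<mu> \<nu> C =
     {\<pi> \<in> couplings \<mu> \<nu>. \<exists>e :: nat \<Rightarrow> real. (\<forall>k. 0 < e k) \<and> decseq e \<and> e \<longlonglongrightarrow> 0 \<and>
        weak_conv_at (\<lambda>k. entropic_plan \<mu> \<nu> C (e k)) \<pi> sequentially}"

definition value_gap ::
    "'a::topological_space measure \<Rightarrow> 'b::topological_space measure \<Rightarrow> ('a \<times> 'b \<Rightarrow> real) \<Rightarrow>
     real \<Rightarrow> ereal" where
  "value_gap \<mu> \<nu> C \<epsilon> =
     (INF \<pi> \<in> couplings \<mu> \<nu>. cost_gap \<mu> \<nu> C \<pi> + ereal \<epsilon> * coupling_entropy \<mu> \<nu> \<pi>)"

definition value_gap_near ::
    "('a \<times> 'b \<Rightarrow> 'a \<times> 'b \<Rightarrow> real) \<Rightarrow> 'a::topological_space measure \<Rightarrow> 'b::topological_space measure \<Rightarrow>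
     ('a \<times> 'b \<Rightarrow> real) \<Rightarrow> ('a \<times> 'b) measure \<Rightarrow> real \<Rightarrow> real \<Rightarrow> ereal" where
  "value_gap_near \<rho> \<mu> \<nu> C \<pi>' r \<epsilon> =
     (INF \<pi> \<in> {\<pi> \<in> couplings \<mu> \<nu>. d_BL \<rho> \<pi> \<pi>' \<le> r}.
        cost_gap \<mu> \<nu> C \<pi> + ereal \<epsilon> * coupling_entropy \<mu> \<nu> \<pi>)"

definition value_gap_out ::
    "('a \<times> 'b \<Rightarrow> 'a \<times> 'b \<Rightarrow> real) \<Rightarrow> 'a::topological_space measure \<Rightarrow> 'b::topological_space measure \<Rightarrow>
     ('a \<times> 'b \<Rightarrow> real) \<Rightarrow> ('a \<times> 'b) measure \<Rightarrow> real \<Rightarrow> real \<Rightarrow> ereal" where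
  "value_gap_out \<rho> \<mu> \<nu> C \<pi>' r \<epsilon> =
     (INF \<pi> \<in> {\<pi> \<in> couplings \<mu> \<nu>. d_BL \<rho> \<pi> \<pi>' \<ge> r}.
        cost_gap \<mu> \<nu> C \<pi> + ereal \<epsilon> * coupling_entropy \<mu> \<nu> \<pi>)"

end

theory Submission
  imports Defs
begin

text \<open>
  The theorem rests on one inequality: for every coupling \<open>\<pi>\<close>,
  \<open>F\<^sub>\<epsilon>(\<pi>) - F\<^sub>\<epsilon>(\<pi>\<^sub>\<epsilon>) \<ge> \<epsilon> / 16 * d\<^sub>B\<^sub>L(\<pi>, \<pi>\<^sub>\<epsilon>)\<^sup>2\<close>
  (\<open>gap_quadratic_growth\<close>). The excess divided by \<open>\<epsilon>\<close> is thus the right scale for measuring the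
  distance to the entropic plan, and both parts compare it for sets of couplings near to or
  far from \<open>\<pi>'\<close>. If \<open>\<pi>\<^sub>\<epsilon>\<close> lies in the set, the excess is \<open>0\<close>; if the set stays at
  distance \<open>s\<close> from \<open>\<pi>\<^sub>\<epsilon>\<close>, the scaled excess is at least \<open>s\<^sup>2 / 16\<close>. Hence a small scaled
  excess over the \<open>r\<close>-ball around \<open>\<pi>'\<close> forces \<open>\<pi>\<^sub>\<epsilon>\<close> to be within a multiple of
  \<open>r\<close> of \<open>\<pi>'\<close>, and a positive excess outside the \<open>r\<close>-ball forces \<open>\<pi>\<^sub>\<epsilon>\<close> into it; the converse
  implications are as short. In the first part a diagonal choice over \<open>r = 1 / (n + 1)\<close>
  produces the decreasing sequence of parameters.

  The inequality comes from a quantitative convexity of \<open>t * ln t\<close> (\<open>mult_ln_midpoint\<close>), which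
  after integration makes the entropic cost strongly convex for the \<open>L\<^sup>1\<close> distance of densities
  with respect to \<open>\<mu> \<Otimes> \<nu>\<close> (\<open>energy_midpoint\<close>). The same estimate shows that minimising sequences
  are Cauchy in \<open>L\<^sup>1\<close>, which gives existence and uniqueness of the plan
  (\<open>minimiser_exists\<close>) by completeness and Fatou's lemma instead of tightness. The marginal
  constraints are affine and continuous in \<open>L\<^sup>1\<close>, so they survive in the limit.

  Statements about \<open>d\<^sub>B\<^sub>L\<close> and about weak convergence are exchanged by
  \<open>weak_conv_at_if_d_BL_tendsto_0\<close> and \<open>d_BL_tendsto_0_if_weak_conv_at\<close>: the first approximates
  continuous functions from below by Lipschitz ones, the second reduces all Lipschitz test functions
  at once to finitely many integrals by a partition of unity subordinate to small balls.
\<close>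

section \<open>The bounded-Lipschitz distance and weak convergence\<close>

abbreviation borel_prob :: "'s::topological_space measure \<Rightarrow> bool" where
  "borel_prob P \<equiv> prob_space P \<and> sets P = sets borel"

lemma integrable_continuous_bounded:
  fixes f :: "'s::topological_space \<Rightarrow> real"
  assumes "borel_prob P" "continuous_on UNIV f" "\<And>x. \<bar>f x\<bar> \<le> B"
  shows "integrable P f"
proof -
  interpret prob_space P using assms(1) by blast
  have "f \<in> borel_measurable P"
    using assms(1) borel_measurable_continuous_onI[OF assms(2)]
    by (simp cong: measurable_cong_sets)
  then show ?thesis
    by (intro integrable_const_bound[where B = B]) (use assms(3) in auto)
qed

lemma abs_integral_le_bound:
  fixes f :: "'s::topological_space \<Rightarrow> real"
  assumes "borel_prob P" "continuous_on UNIV f" "\<And>x. \<bar>f x\<bar> \<le> B"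
  shows "\<bar>\<integral>x. f x \<partial>P\<bar> \<le> B"
proof -
  interpret prob_space P using assms(1) by blast
  have int: "integrable P f" by (rule integrable_continuous_bounded[OF assms])
  have "(\<integral>x. f x \<partial>P) \<le> B"
    by (rule integral_le_const[OF int]) (use assms(3) abs_le_D1 in auto)
  moreover have "- B \<le> (\<integral>x. f x \<partial>P)"
    by (rule integral_ge_const[OF int]) (use assms(3) in \<open>auto simp: abs_le_iff minus_le_iff\<close>)
  ultimately show ?thesis by auto
qed

text \<open>
  The bounded-Lipschitz distance metrises weak convergence of probability measures on a separable
  metric space. The metric is a plain function here because the product space carries
  an arbitrary metric inducing its topology, possibly different from the one of its type.
\<close>
locale compatible_metric = Metric_space UNIV \<rho>
  for \<rho> :: "'s::second_countable_topology \<Rightarrow> 's \<Rightarrow> real" +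
  assumes mtopology_eq: "mtopology = euclidean"
begin

lemma open_ball: "open {y. \<rho> x y < r}"
proof -
  have "openin mtopology (mball x r)" by (rule openin_mball)
  then show ?thesis by (simp add: mtopology_eq mball_def)
qed

lemma open_contains_mball:
  assumes "open U" "x \<in> U"
  obtains r where "r > 0" "\<And>y. \<rho> x y < r \<Longrightarrow> y \<in> U"
proof -
  have "openin mtopology U" using assms(1) by (simp add: mtopology_eq)
  then obtain r where "r > 0" "mball x r \<subseteq> U" using assms(2) by (auto simp: openin_mtopology)
  then show ?thesis using that by (auto simp: subset_iff)
qed

lemma lipschitz_continuous:
  fixes f :: "'s \<Rightarrow> real"
  assumes "\<And>x y. \<bar>f x - f y\<bar> \<le> L * \<rho> x y"
  shows "continuous_on UNIV f"
proof -
  have "(f \<longlongrightarrow> f x) (at x)" for x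
  proof (rule tendstoI)
    fix e :: real assume e: "e > 0"
    have "dist (f y) (f x) < e" if "\<rho> x y < e / (\<bar>L\<bar> + 1)" for y
    proof -
      have "\<bar>f x - f y\<bar> \<le> (\<bar>L\<bar> + 1) * \<rho> x y"
        using assms[of x y] mult_right_mono[OF _ nonneg, of L "\<bar>L\<bar> + 1" x y] by linarith
      also have "\<dots> < e" using that by (simp add: field_simps)
      finally show ?thesis by (simp add: dist_real_def abs_minus_commute)
    qed
    then show "\<forall>\<^sub>F y in at x. dist (f y) (f x) < e"
      using open_ball[of x "e / (\<bar>L\<bar> + 1)"] e
      unfolding eventually_at_topological
      by (intro exI[of _ "{y. \<rho> x y < e / (\<bar>L\<bar> + 1)}"]) auto
  qed
  then show ?thesis by (simp add: continuous_on)
qed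

lemma continuous_metric: "continuous_on UNIV (\<lambda>x. \<rho> x a)"
  by (rule lipschitz_continuous[where L = 1]) (simp add: abs_le_iff, metis add.commute commute diff_le_eq triangle UNIV_I)

lemma Lip_leI:
  assumes "\<And>x y. \<bar>f x - f y\<bar> \<le> \<rho> x y"
  shows "Lip \<rho> f \<le> 1"
  unfolding Lip_def
proof (rule SUP_least)
  fix p :: "'s \<times> 's" assume "p \<in> {(z, z'). z \<noteq> z'}"
  then obtain x y where p: "p = (x, y)" "x \<noteq> y" by auto
  then have "0 < \<rho> x y" by simp
  then show "(case p of (z, z') \<Rightarrow> ennreal (\<bar>f z - f z'\<bar> / \<rho> z z')) \<le> 1"
    using assms[of x y] by (simp add: p)
qed

lemma Lip_leD:
  assumes "Lip \<rho> f \<le> 1"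
  shows "\<bar>f x - f y\<bar> \<le> \<rho> x y"
proof (cases "x = y")
  case False
  then have pos: "0 < \<rho> x y" by simp
  have "ennreal (\<bar>f x - f y\<bar> / \<rho> x y) \<le> Lip \<rho> f"
    unfolding Lip_def using False by (intro SUP_upper2[of "(x, y)"]) auto
  then have "\<bar>f x - f y\<bar> / \<rho> x y \<le> 1" using assms by (metis ennreal_le_1 order_trans)
  then show ?thesis using pos by simp
qed simp

lemma d_BL_least:
  assumes "\<And>f. continuous_on UNIV f \<Longrightarrow> (\<And>x. \<bar>f x\<bar> \<le> 1) \<Longrightarrow> (\<And>x y. \<bar>f x - f y\<bar> \<le> \<rho> x y) \<Longrightarrow>
             \<bar>(\<integral>x. f x \<partial>P) - (\<integral>x. f x \<partial>Q)\<bar> \<le> b"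
  shows "d_BL \<rho> P Q \<le> b"
  unfolding d_BL_def
proof (rule cSUP_least)
  have "norm (0 :: 's \<Rightarrow>\<^sub>C real) \<le> 1 \<and> Lip \<rho> (apply_bcontfun 0) \<le> 1"
    by (intro conjI Lip_leI) auto
  then show "{f :: 's \<Rightarrow>\<^sub>C real. norm f \<le> 1 \<and> Lip \<rho> (apply_bcontfun f) \<le> 1} \<noteq> {}" by blast
next
  fix f :: "'s \<Rightarrow>\<^sub>C real"
  assume "f \<in> {f. norm f \<le> 1 \<and> Lip \<rho> (apply_bcontfun f) \<le> 1}"
  then have f: "norm f \<le> 1" "Lip \<rho> (apply_bcontfun f) \<le> 1" by auto
  show "\<bar>(\<integral>x. apply_bcontfun f x \<partial>P) - (\<integral>x. apply_bcontfun f x \<partial>Q)\<bar> \<le> b"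
  proof (rule assms)
    show "\<bar>apply_bcontfun f x\<bar> \<le> 1" for x using norm_bounded[of f x] f(1) by simp
  qed (use Lip_leD[OF f(2)] in auto)
qed

lemma abs_integral_diff_le_d_BL:
  assumes "borel_prob P" "borel_prob Q" and c: "0 < c"
    and bd: "\<And>x. \<bar>f x\<bar> \<le> c" and lip: "\<And>x y. \<bar>f x - f y\<bar> \<le> c * \<rho> x y"
  shows "\<bar>(\<integral>x. f x \<partial>P) - (\<integral>x. f x \<partial>Q)\<bar> \<le> c * d_BL \<rho> P Q"
proof -
  let ?T = "{f :: 's \<Rightarrow>\<^sub>C real. norm f \<le> 1 \<and> Lip \<rho> (apply_bcontfun f) \<le> 1}"
  let ?g = "\<lambda>x. f x / c"
  have cont: "continuous_on UNIV ?g"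
    using lipschitz_continuous[OF lip] c by (intro continuous_intros) auto
  have bd': "\<bar>?g x\<bar> \<le> 1" for x using bd[of x] c by simp
  define G where "G = Bcontfun ?g"
  have G: "apply_bcontfun G = ?g"
    unfolding G_def using cont bd' by (intro Bcontfun_inverse bcontfun_normI[where b = 1]) auto
  have "\<bar>?g x - ?g y\<bar> \<le> \<rho> x y" for x y
    using lip[of x y] c by (simp add: field_simps flip: diff_divide_distrib)
  then have "G \<in> ?T"
    using bd' by (auto simp: G intro!: norm_bound Lip_leI)
  moreover have "bdd_above ((\<lambda>f. \<bar>(\<integral>z. apply_bcontfun f z \<partial>P) - (\<integral>z. apply_bcontfun f z \<partial>Q)\<bar>) ` ?T)"
  proof (rule bdd_aboveI2)
    fix h :: "'s \<Rightarrow>\<^sub>C real" assume "h \<in> ?T"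
    then have "\<bar>apply_bcontfun h x\<bar> \<le> 1" for x using norm_bounded[of h x] by simp
    then have "\<bar>\<integral>z. apply_bcontfun h z \<partial>P\<bar> \<le> 1" "\<bar>\<integral>z. apply_bcontfun h z \<partial>Q\<bar> \<le> 1"
      using assms by (auto intro!: abs_integral_le_bound)
    then show "\<bar>(\<integral>z. apply_bcontfun h z \<partial>P) - (\<integral>z. apply_bcontfun h z \<partial>Q)\<bar> \<le> 2" by linarith
  qed
  ultimately have "\<bar>(\<integral>x. apply_bcontfun G x \<partial>P) - (\<integral>x. apply_bcontfun G x \<partial>Q)\<bar> \<le> d_BL \<rho> P Q"
    unfolding d_BL_def by (rule cSUP_upper)
  then have "\<bar>((\<integral>x. f x \<partial>P) - (\<integral>x. f x \<partial>Q)) / c\<bar> \<le> d_BL \<rho> P Q"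
    by (simp add: G diff_divide_distrib)
  then show ?thesis using c by (simp add: abs_divide pos_divide_le_eq mult.commute)
qed

lemma d_BL_nonneg: "borel_prob P \<Longrightarrow> borel_prob Q \<Longrightarrow> 0 \<le> d_BL \<rho> P Q"
  using abs_integral_diff_le_d_BL[of P Q 1 "\<lambda>_. 0"] by simp

lemma d_BL_commute: "d_BL \<rho> P Q = d_BL \<rho> Q P"
  unfolding d_BL_def by (simp add: abs_minus_commute)

lemma d_BL_triangle:
  assumes "borel_prob P" "borel_prob Q" "borel_prob R"
  shows "d_BL \<rho> P R \<le> d_BL \<rho> P Q + d_BL \<rho> Q R"
proof (rule d_BL_least)
  fix f :: "'s \<Rightarrow> real"
  assume "\<And>x. \<bar>f x\<bar> \<le> 1" "\<And>x y. \<bar>f x - f y\<bar> \<le> \<rho> x y"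
  then show "\<bar>(\<integral>x. f x \<partial>P) - (\<integral>x. f x \<partial>R)\<bar> \<le> d_BL \<rho> P Q + d_BL \<rho> Q R"
    using abs_integral_diff_le_d_BL[of P Q 1 f] abs_integral_diff_le_d_BL[of Q R 1 f] assms
    by fastforce
qed

text \<open>
  The Pasch--Hausdorff envelope: the largest \<open>k\<close>-Lipschitz minorant of \<open>f\<close>. As
  \<open>k\<close> grows these envelopes recover a bounded continuous \<open>f\<close>, so that Lipschitz test
  functions determine the integrals of all bounded continuous ones, without any appeal to
  uniform continuity.
\<close>
definition inf_convolution :: "('s \<Rightarrow> real) \<Rightarrow> real \<Rightarrow> 's \<Rightarrow> real" where
  "inf_convolution f k x = (INF y. f y + k * \<rho> x y)"

lemma inf_convolution_bounds:
  fixes f :: "'s \<Rightarrow> real"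
  assumes bd: "\<And>x. \<bar>f x\<bar> \<le> B" and k: "0 \<le> k"
  shows "inf_convolution f k x \<le> f x" "\<bar>inf_convolution f k x\<bar> \<le> B"
    and "\<bar>inf_convolution f k x - inf_convolution f k y\<bar> \<le> k * \<rho> x y"
proof -
  have low: "- B \<le> f y + k * \<rho> x y" for x y
    using bd[of y] k mult_nonneg_nonneg[OF k nonneg, of x y] by linarith
  then have bb: "bdd_below (range (\<lambda>y. f y + k * \<rho> x y))" for x
    by (intro bdd_belowI2)
  show le: "inf_convolution f k x \<le> f x" for x
    unfolding inf_convolution_def using cINF_lower[OF bb, of x x] by simp
  have "- B \<le> inf_convolution f k x" for x
    unfolding inf_convolution_def by (rule cINF_greatest) (use low in auto)
  then show "\<bar>inf_convolution f k x\<bar> \<le> B"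
    using le[of x] bd[of x] by (smt (verit))
  have "inf_convolution f k x - k * \<rho> x y \<le> inf_convolution f k y" for x y
    unfolding inf_convolution_def[of _ _ y]
  proof (rule cINF_greatest)
    fix z
    have "inf_convolution f k x \<le> f z + k * \<rho> x z"
      unfolding inf_convolution_def by (rule cINF_lower[OF bb]) auto
    moreover have "k * \<rho> x z \<le> k * \<rho> x y + k * \<rho> y z"
      using mult_left_mono[OF triangle[of x y z] k] by (simp add: distrib_left)
    ultimately show "inf_convolution f k x - k * \<rho> x y \<le> f z + k * \<rho> y z" by simp
  qed auto
  from this[of x y] this[of y x]
  show "\<bar>inf_convolution f k x - inf_convolution f k y\<bar> \<le> k * \<rho> x y"
    by (simp add: commute abs_le_iff algebra_simps)
qed

lemma inf_convolution_tendsto: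
  fixes f :: "'s \<Rightarrow> real"
  assumes bd: "\<And>x. \<bar>f x\<bar> \<le> B" and cont: "continuous_on UNIV f"
  shows "(\<lambda>n. inf_convolution f (real n) x) \<longlonglongrightarrow> f x"
proof (rule LIMSEQ_I)
  fix e :: real assume e: "e > 0"
  have "open {y. f x - e/2 < f y}"
    by (intro open_Collect_less continuous_intros cont)
  then obtain d where d: "d > 0" "\<And>y. \<rho> x y < d \<Longrightarrow> f x - e/2 < f y"
    by (rule open_contains_mball[of _ x]) (use e in auto)
  obtain N :: nat where N: "real N > 2 * B / d" using reals_Archimedean2 by blast
  have "norm (inf_convolution f (real n) x - f x) < e" if n: "n \<ge> N" for n
  proof -
    have "f x - e/2 \<le> inf_convolution f (real n) x"
      unfolding inf_convolution_def
    proof (rule cINF_greatest)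
      fix y
      \<comment> \<open>Near \<open>x\<close> continuity gives the bound; far from \<open>x\<close> the penalty exceeds
        \<open>2 * B\<close>, which bounds the oscillation of \<open>f\<close>.\<close>
      show "f x - e / 2 \<le> f y + real n * \<rho> x y"
      proof (cases "\<rho> x y < d")
        case True
        then show ?thesis using d(2)[of y] by (simp add: add_increasing2 less_imp_le)
      next
        case False
        have "2 * B < real N * d" using N d(1) by (simp add: field_simps)
        also have "\<dots> \<le> real n * \<rho> x y"
          using False n d(1) by (intro mult_mono) auto
        finally show ?thesis using bd[of x] bd[of y] e by linarith
      qed
    qed auto
    then show ?thesis using inf_convolution_bounds(1)[where f = f and k = "real n" and x = x, OF bd] e by simp
  qed
  then show "\<exists>N. \<forall>n\<ge>N. norm (inf_convolution f (real n) x - f x) < e" by blast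
qed

text \<open>
  Only a lower bound is available from approximation from below; applying it to \<open>f\<close> and
  to \<open>- f\<close> gives convergence of the integrals.
\<close>
lemma eventually_integral_gt_if_d_BL_tendsto_0:
  fixes f :: "'s \<Rightarrow> real"
  assumes P: "\<forall>\<^sub>F i in F. borel_prob (P i)" and Q: "borel_prob Q"
    and lim: "((\<lambda>i. d_BL \<rho> (P i) Q) \<longlongrightarrow> 0) F"
    and cont: "continuous_on UNIV f" and bd: "\<And>x. \<bar>f x\<bar> \<le> B" and e: "e > 0"
  shows "\<forall>\<^sub>F i in F. (\<integral>x. f x \<partial>Q) - e < (\<integral>x. f x \<partial>P i)"
proof -
  let ?f = "\<lambda>n. inf_convolution f (real n)"
  have props: "?f n x \<le> f x" "\<bar>?f n x\<bar> \<le> B" "\<bar>?f n x - ?f n y\<bar> \<le> real n * \<rho> x y" for n x y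
    by (rule inf_convolution_bounds[where B = B]; simp add: bd)+
  have cont': "continuous_on UNIV (?f n)" for n
    by (rule lipschitz_continuous[where L = "real n"]) (use props(3) in auto)
  have "(\<lambda>n. \<integral>x. ?f n x \<partial>Q) \<longlonglongrightarrow> (\<integral>x. f x \<partial>Q)"
  proof (rule integral_dominated_convergence)
    show "f \<in> borel_measurable Q" "?f n \<in> borel_measurable Q" for n
      using integrable_continuous_bounded[OF Q cont bd]
        integrable_continuous_bounded[OF Q cont'] props(2) by auto
    show "integrable Q (\<lambda>_. B)" by (rule integrable_continuous_bounded[OF Q, where B = "\<bar>B\<bar>"]) auto
    show "AE x in Q. norm (?f n x) \<le> B" for n using props(2) by auto
    show "AE x in Q. (\<lambda>n. ?f n x) \<longlonglongrightarrow> f x"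
      by (intro AE_I2 inf_convolution_tendsto[OF bd cont])
  qed
  then have "\<forall>\<^sub>F n in sequentially. (\<integral>x. f x \<partial>Q) - e/2 < (\<integral>x. ?f n x \<partial>Q)"
    by (rule order_tendstoD) (use e in auto)
  then obtain n where n: "(\<integral>x. f x \<partial>Q) - e/2 < (\<integral>x. ?f n x \<partial>Q)"
    by (auto simp: eventually_sequentially)
  define c where "c = max 1 (max B (real n))"
  have c: "0 < c" "B \<le> c" "real n \<le> c" by (auto simp: c_def)
  have "\<forall>\<^sub>F i in F. d_BL \<rho> (P i) Q < e / (2 * c)"
    by (rule order_tendstoD(2)[OF lim]) (use e c in auto)
  with P show ?thesis
  proof eventually_elim
    case (elim i)
    have "\<bar>(\<integral>x. ?f n x \<partial>P i) - (\<integral>x. ?f n x \<partial>Q)\<bar> \<le> c * d_BL \<rho> (P i) Q"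
    proof (rule abs_integral_diff_le_d_BL[OF elim(1) Q c(1)])
      show "\<bar>?f n x\<bar> \<le> c" for x using props(2)[of n x] c by linarith
      show "\<bar>?f n x - ?f n y\<bar> \<le> c * \<rho> x y" for x y
        using props(3)[of n x y] mult_right_mono[OF c(3) nonneg, of x y] by linarith
    qed
    also have "\<dots> < e / 2" using elim(2) c by (simp add: field_simps)
    finally have "(\<integral>x. f x \<partial>Q) - e < (\<integral>x. ?f n x \<partial>P i)" using n by linarith
    also have "\<dots> \<le> (\<integral>x. f x \<partial>P i)"
      by (intro integral_mono integrable_continuous_bounded[OF elim(1) cont' props(2)]
          integrable_continuous_bounded[OF elim(1) cont bd] props(1))
    finally show ?case .
  qed
qed

lemma weak_conv_at_if_d_BL_tendsto_0:
  assumes P: "\<forall>\<^sub>F i in F. borel_prob (P i)" and Q: "borel_prob Q"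
    and lim: "((\<lambda>i. d_BL \<rho> (P i) Q) \<longlongrightarrow> 0) F"
  shows "weak_conv_at P Q F"
  unfolding weak_conv_at_def
proof (intro allI tendstoI)
  fix f :: "'s \<Rightarrow>\<^sub>C real" and e :: real assume e: "e > 0"
  have bd: "\<bar>apply_bcontfun f x\<bar> \<le> norm f" for x using norm_bounded[of f x] by simp
  have "\<forall>\<^sub>F i in F. (\<integral>x. apply_bcontfun f x \<partial>Q) - e < (\<integral>x. apply_bcontfun f x \<partial>P i)"
    by (rule eventually_integral_gt_if_d_BL_tendsto_0[OF P Q lim _ bd e]) simp
  moreover
  have "\<forall>\<^sub>F i in F. (\<integral>x. - apply_bcontfun f x \<partial>Q) - e < (\<integral>x. - apply_bcontfun f x \<partial>P i)"
    using bd
    by (intro eventually_integral_gt_if_d_BL_tendsto_0[OF P Q lim _ _ e] continuous_intros) auto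
  ultimately show "\<forall>\<^sub>F i in F. dist (\<integral>x. apply_bcontfun f x \<partial>P i) (\<integral>x. apply_bcontfun f x \<partial>Q) < e"
    by eventually_elim (simp add: dist_real_def abs_less_iff)
qed

lemma weak_conv_at_continuous:
  fixes f :: "'s \<Rightarrow> real"
  assumes "weak_conv_at P Q F" "continuous_on UNIV f" "\<And>x. \<bar>f x\<bar> \<le> B"
  shows "((\<lambda>i. \<integral>x. f x \<partial>P i) \<longlongrightarrow> (\<integral>x. f x \<partial>Q)) F"
proof -
  have "apply_bcontfun (Bcontfun f) = f"
    using assms by (intro Bcontfun_inverse bcontfun_normI[where b = B]) auto
  then show ?thesis using assms(1) unfolding weak_conv_at_def by metis
qed

text \<open>
  The converse direction has to be uniform over the whole class of Lipschitz test functions. This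
  partition of unity replaces tightness: up to a remainder \<open>\<theta>\<close> of small
  \<open>Q\<close>-integral, all mass is carried by finitely many continuous bumps of diameter of order
  \<open>d\<close>. The bumps are \<open>d - \<rho> x (a j)\<close> around the points of a dense sequence, normalised with
  an extra constant \<open>w N\<close> in the denominator that keeps the quotients continuous where all bumps
  vanish; this constant is what produces \<open>\<theta>\<close>, and it tends to \<open>0\<close> as more bumps are
  used.
\<close>
lemma finite_partition_of_unity:
  assumes Q: "borel_prob Q" and d: "0 < d"
  obtains N :: nat and a :: "nat \<Rightarrow> 's" and \<psi> :: "nat \<Rightarrow> 's \<Rightarrow> real" and \<theta> :: "'s \<Rightarrow> real"
  where "\<And>j. continuous_on UNIV (\<psi> j)" "continuous_on UNIV \<theta>"
    and "\<And>j x. 0 \<le> \<psi> j x" "\<And>x. 0 \<le> \<theta> x" "\<And>x. (\<Sum>j<N. \<psi> j x) + \<theta> x = 1"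
    and "\<And>j x. \<psi> j x \<noteq> 0 \<Longrightarrow> \<rho> x (a j) < d" "(\<integral>x. \<theta> x \<partial>Q) < d"
proof -
  obtain D :: "'s set" where D: "countable D" "\<And>U. open U \<Longrightarrow> U \<noteq> {} \<Longrightarrow> \<exists>a\<in>D. a \<in> U"
    using countable_dense_exists by metis
  have "D \<noteq> {}" using D(2)[of UNIV] by auto
  define a where "a = from_nat_into D"
  define g where "g j x = max 0 (d - \<rho> x (a j))" for j x
  define w where "w N = 1 / real (Suc N)" for N
  define \<theta> where "\<theta> N x = w N / (w N + (\<Sum>j<N. g j x))" for N x
  define \<psi> where "\<psi> N j x = g j x / (w N + (\<Sum>j<N. g j x))" for N j x
  have w: "0 < w N" for N by (simp add: w_def)
  have g0: "0 \<le> g j x" for j x by (simp add: g_def)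
  have den: "0 < w N + (\<Sum>j<N. g j x)" for N x
    by (intro add_pos_nonneg sum_nonneg g0 w)
  have den0: "\<forall>x\<in>UNIV. w N + (\<Sum>j<N. g j x) \<noteq> 0" for N
    using den by (metis less_irrefl)
  have cg: "continuous_on UNIV (g j)" for j
    unfolding g_def by (intro continuous_intros continuous_metric)
  have cden: "continuous_on UNIV (\<lambda>x. w N + (\<Sum>j<N. g j x))" for N
    by (intro continuous_on_add continuous_on_sum continuous_on_const cg)
  have c\<theta>: "continuous_on UNIV (\<theta> N)" for N
    unfolding \<theta>_def by (rule continuous_on_divide[OF continuous_on_const cden den0])
  have c\<psi>: "continuous_on UNIV (\<psi> N j)" for N j
    unfolding \<psi>_def by (rule continuous_on_divide[OF cg cden den0])
  have \<theta>0: "0 \<le> \<theta> N x" for N x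
    unfolding \<theta>_def by (intro divide_nonneg_pos less_imp_le w den)
  have \<psi>0: "0 \<le> \<psi> N j x" for N j x
    unfolding \<psi>_def by (intro divide_nonneg_pos g0 den)
  have sum1: "(\<Sum>j<N. \<psi> N j x) + \<theta> N x = 1" for N x
  proof -
    have "(\<Sum>j<N. \<psi> N j x) + \<theta> N x
        = ((\<Sum>j<N. g j x) + w N) / (w N + (\<Sum>j<N. g j x))"
      unfolding \<psi>_def \<theta>_def by (simp only: sum_divide_distrib add_divide_distrib)
    also have "\<dots> = 1" using den0[of N] by (simp add: add.commute)
    finally show ?thesis .
  qed
  have \<theta>1: "\<theta> N x \<le> 1" for N x
    using sum1[of N x] sum_nonneg[of "{..<N}" "\<lambda>j. \<psi> N j x"] \<psi>0 by simp
  have lim: "(\<lambda>N. \<theta> N x) \<longlonglongrightarrow> 0" for x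
  proof -
    obtain j where j: "\<rho> x (a j) < d"
    proof -
      have "x \<in> {y. \<rho> x y < d}" using d by simp
      then obtain b where "b \<in> D" "\<rho> x b < d"
        using D(2)[OF open_ball[of x d]] by blast
      then show ?thesis using that from_nat_into_surj[OF D(1)] unfolding a_def by metis
    qed
    define c where "c = g j x"
    have c: "c > 0" using j by (simp add: c_def g_def)
    have "w \<longlonglongrightarrow> 0"
      unfolding w_def using LIMSEQ_Suc[OF lim_1_over_n[where 'a = real]] by simp
    then have lim0: "(\<lambda>N. w N / c) \<longlonglongrightarrow> 0"
      by (rule tendsto_divide_zero)
    show ?thesis
    proof (rule tendsto_sandwich[OF _ _ tendsto_const lim0])
      show "\<forall>\<^sub>F N in sequentially. \<theta> N x \<le> w N / c"
        unfolding eventually_sequentially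
      proof (intro exI allI impI)
        fix N assume "Suc j \<le> N"
        then have "c \<le> (\<Sum>j<N. g j x)"
          unfolding c_def by (intro member_le_sum g0) auto
        then have "c \<le> w N + (\<Sum>j<N. g j x)" using w[of N] by linarith
        then show "\<theta> N x \<le> w N / c"
          unfolding \<theta>_def using c w[of N] den by (intro divide_left_mono mult_pos_pos) auto
      qed
    qed (use \<theta>0 in auto)
  qed
  have "(\<lambda>N. \<integral>x. \<theta> N x \<partial>Q) \<longlonglongrightarrow> (\<integral>x. 0 \<partial>Q)"
  proof (rule integral_dominated_convergence)
    show "\<theta> N \<in> borel_measurable Q" for N
      using integrable_continuous_bounded[OF Q c\<theta>, of N 1] \<theta>0 \<theta>1 by simp
    show "integrable Q (\<lambda>_. 1 :: real)" by (rule integrable_continuous_bounded[OF Q]) auto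
  qed (use lim \<theta>0 \<theta>1 in auto)
  then have "\<forall>\<^sub>F N in sequentially. (\<integral>x. \<theta> N x \<partial>Q) < d"
    by (intro order_tendstoD) (use d in auto)
  then obtain N where N: "(\<integral>x. \<theta> N x \<partial>Q) < d" by (auto simp: eventually_sequentially)
  have supp: "\<rho> x (a j) < d" if "\<psi> N j x \<noteq> 0" for j x
    using that by (auto simp: \<psi>_def g_def max_def split: if_splits)
  show ?thesis
    by (rule that[OF c\<psi> c\<theta> \<psi>0 \<theta>0 sum1 supp N])
qed

lemma partition_of_unity_le_1:
  fixes \<psi> :: "nat \<Rightarrow> 's \<Rightarrow> real"
  assumes "\<And>j x. 0 \<le> \<psi> j x" "\<And>x. 0 \<le> \<theta> x" "\<And>x. (\<Sum>j<N. \<psi> j x) + \<theta> x = 1"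
  shows "j < N \<Longrightarrow> \<bar>\<psi> j x\<bar> \<le> 1" "\<bar>\<theta> x\<bar> \<le> 1"
proof -
  have "0 \<le> (\<Sum>j<N. \<psi> j x)" by (intro sum_nonneg assms)
  then show "\<bar>\<theta> x\<bar> \<le> 1" using assms(2,3)[of x] by linarith
  assume "j < N"
  then have "\<psi> j x \<le> (\<Sum>j<N. \<psi> j x)" by (intro member_le_sum assms) auto
  then show "\<bar>\<psi> j x\<bar> \<le> 1" using assms(1)[of j x] assms(2,3)[of x] by linarith
qed

text \<open>
  Freezing a 1-Lipschitz function at the centres of the bumps costs at most \<open>d\<close> plus the
  remainder. The values \<open>f (a j)\<close> are bounded by \<open>1\<close>, so the approximating expressions for two
  measures differ by at most the sum of the differences of the finitely many integrals of
  \<open>\<psi> j\<close>, uniformly in \<open>f\<close>.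
\<close>
lemma integral_diff_le_partition:
  fixes \<psi> :: "nat \<Rightarrow> 's \<Rightarrow> real"
  assumes P: "borel_prob P"
    and c: "\<And>j. continuous_on UNIV (\<psi> j)" "continuous_on UNIV \<theta>"
    and nn: "\<And>j x. 0 \<le> \<psi> j x" "\<And>x. 0 \<le> \<theta> x" and sum1: "\<And>x. (\<Sum>j<N. \<psi> j x) + \<theta> x = 1"
    and supp: "\<And>j x. \<psi> j x \<noteq> 0 \<Longrightarrow> \<rho> x (a j) < d" and d: "0 \<le> d"
    and f: "continuous_on UNIV f" "\<And>x. \<bar>f x\<bar> \<le> 1" "\<And>x y. \<bar>f x - f y\<bar> \<le> \<rho> x y"
  shows "\<bar>(\<integral>x. f x \<partial>P) - (\<Sum>j<N. f (a j) * (\<integral>x. \<psi> j x \<partial>P))\<bar> \<le> d + (\<integral>x. \<theta> x \<partial>P)"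
proof -
  interpret prob_space P using P by blast
  have le1: "j < N \<Longrightarrow> \<bar>\<psi> j x\<bar> \<le> 1" "\<bar>\<theta> x\<bar> \<le> 1" for j x
    by (rule partition_of_unity_le_1[OF nn sum1]; assumption)+
  have i\<psi>: "integrable P (\<psi> j)" if "j < N" for j
    using integrable_continuous_bounded[OF P c(1)] le1(1)[OF that] by blast
  have i\<theta>: "integrable P \<theta>"
    using integrable_continuous_bounded[OF P c(2)] le1(2) by blast
  have ifx: "integrable P f" by (rule integrable_continuous_bounded[OF P f(1,2)])
  have isum: "integrable P (\<lambda>x. \<Sum>j<N. f (a j) * \<psi> j x)"
    by (intro Bochner_Integration.integrable_sum integrable_mult_right i\<psi>) auto
  have pt: "\<bar>f x - (\<Sum>j<N. f (a j) * \<psi> j x)\<bar> \<le> d + \<theta> x" for x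
  proof -
    have "f x = f x * ((\<Sum>j<N. \<psi> j x) + \<theta> x)" using sum1[of x] by simp
    then have "f x - (\<Sum>j<N. f (a j) * \<psi> j x) = (\<Sum>j<N. (f x - f (a j)) * \<psi> j x) + f x * \<theta> x"
      by (simp add: algebra_simps sum_distrib_left sum_subtractf)
    moreover have "\<bar>\<Sum>j<N. (f x - f (a j)) * \<psi> j x\<bar> \<le> (\<Sum>j<N. d * \<psi> j x)"
    proof (rule order_trans[OF sum_abs], rule sum_mono)
      fix j
      show "\<bar>(f x - f (a j)) * \<psi> j x\<bar> \<le> d * \<psi> j x"
      proof (cases "\<psi> j x = 0")
        case False
        then have "\<bar>f x - f (a j)\<bar> \<le> d" using f(3)[of x "a j"] supp[of j x] by linarith
        then show ?thesis using nn(1)[of j x] by (simp add: abs_mult mult_right_mono)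
      qed simp
    qed
    moreover have "(\<Sum>j<N. d * \<psi> j x) \<le> d"
      using sum1[of x] nn(2)[of x] d by (simp add: mult_left_le flip: sum_distrib_left)
    moreover have "\<bar>f x * \<theta> x\<bar> \<le> \<theta> x"
      using f(2)[of x] nn(2)[of x] by (simp add: abs_mult mult_left_le_one_le)
    ultimately show ?thesis by linarith
  qed
  have "(\<integral>x. f x \<partial>P) - (\<Sum>j<N. f (a j) * (\<integral>x. \<psi> j x \<partial>P))
      = (\<integral>x. f x - (\<Sum>j<N. f (a j) * \<psi> j x) \<partial>P)"
    using ifx  isum i\<psi> by (simp add: Bochner_Integration.integral_sum)
  also have "\<bar>\<dots>\<bar> \<le> (\<integral>x. d + \<theta> x \<partial>P)"
    using pt ifx  isum i\<theta> by (intro integral_abs_bound[THEN order_trans] integral_mono) auto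
  also have "\<dots> = d + (\<integral>x. \<theta> x \<partial>P)" using i\<theta> prob_space by simp
  finally show ?thesis .
qed

lemma d_BL_tendsto_0_if_weak_conv_at:
  assumes P: "\<forall>\<^sub>F i in F. borel_prob (P i)" and Q: "borel_prob Q"
    and conv: "weak_conv_at P Q F"
  shows "((\<lambda>i. d_BL \<rho> (P i) Q) \<longlongrightarrow> 0) F"
proof (rule tendstoI)
  fix e :: real assume e: "e > 0"
  define d where "d = e / 8"
  have d: "d > 0" using e by (simp add: d_def)
  obtain N :: nat and a \<psi> \<theta>
    where c: "\<And>j. continuous_on UNIV (\<psi> j)" "continuous_on UNIV \<theta>"
      and nn: "\<And>j x. 0 \<le> \<psi> j x" "\<And>x. 0 \<le> \<theta> x" and sum1: "\<And>x. (\<Sum>j<N. \<psi> j x) + \<theta> x = 1"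
      and supp: "\<And>j x. \<psi> j x \<noteq> 0 \<Longrightarrow> \<rho> x (a j) < d" and small: "(\<integral>x. \<theta> x \<partial>Q) < d"
    by (rule finite_partition_of_unity[OF Q d]) blast
  have le1: "j < N \<Longrightarrow> \<bar>\<psi> j x\<bar> \<le> 1" "\<bar>\<theta> x\<bar> \<le> 1" for j x
    by (rule partition_of_unity_le_1[OF nn sum1]; assumption)+
  let ?S = "\<lambda>i. \<Sum>j<N. \<bar>(\<integral>x. \<psi> j x \<partial>P i) - (\<integral>x. \<psi> j x \<partial>Q)\<bar>"
  have "(?S \<longlongrightarrow> (\<Sum>j<N. \<bar>(\<integral>x. \<psi> j x \<partial>Q) - (\<integral>x. \<psi> j x \<partial>Q)\<bar>)) F"
    by (intro tendsto_sum tendsto_rabs tendsto_diff tendsto_const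
          weak_conv_at_continuous[OF conv c(1), where B = 1] le1(1)) auto
  then have "(?S \<longlongrightarrow> 0) F" by simp
  then have "\<forall>\<^sub>F i in F. ?S i < d" by (rule order_tendstoD(2)) (rule d)
  moreover have "\<forall>\<^sub>F i in F. (\<integral>x. \<theta> x \<partial>P i) < d"
    by (rule order_tendstoD(2)[OF weak_conv_at_continuous[OF conv c(2), where B = 1] small]) (rule le1(2))
  ultimately show "\<forall>\<^sub>F i in F. dist (d_BL \<rho> (P i) Q) 0 < e"
    using P
  proof eventually_elim
    case (elim i)
    have "d_BL \<rho> (P i) Q \<le> 5 * d"
    proof (rule d_BL_least)
      fix f :: "'s \<Rightarrow> real"
      assume f: "continuous_on UNIV f" "\<And>x. \<bar>f x\<bar> \<le> 1" "\<And>x y. \<bar>f x - f y\<bar> \<le> \<rho> x y"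
      have "\<bar>(\<Sum>j<N. f (a j) * (\<integral>x. \<psi> j x \<partial>P i)) - (\<Sum>j<N. f (a j) * (\<integral>x. \<psi> j x \<partial>Q))\<bar> \<le> ?S i"
        unfolding sum_subtractf[symmetric] right_diff_distrib[symmetric]
        by (rule order_trans[OF sum_abs], rule sum_mono)
          (use f(2) in \<open>simp add: abs_mult mult_left_le_one_le\<close>)
      then show "\<bar>(\<integral>x. f x \<partial>P i) - (\<integral>x. f x \<partial>Q)\<bar> \<le> 5 * d"
        using supp integral_diff_le_partition[OF elim(3) c nn sum1 _ _ f, where a = a and d = d]
          integral_diff_le_partition[OF Q c nn sum1 _ _ f, where a = a and d = d] elim small d
        by (smt (verit))
    qed
    then show ?case using d_BL_nonneg[OF elim(3) Q] e by (simp add: d_def)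
  qed
qed

end

section \<open>Strong convexity of entropic minimisation problems\<close>

text \<open>
  The convex duality between \<open>t * ln t\<close> and the exponential, in the variable \<open>ln l\<close>.
\<close>
lemma mult_ln_ge_tangent:
  fixes a m l :: real
  assumes "0 \<le> a" "0 < m" "0 < l"
  shows "a * ln l + a - l * m \<le> a * ln a - a * ln m"
proof (cases "a = 0")
  case False
  with assms have a: "0 < a" by simp
  have "ln (l * m / a) \<le> l * m / a - 1"
    by (rule ln_le_minus_one) (use a assms in simp)
  then have "a * (ln l + ln m - ln a) \<le> a * (l * m / a - 1)"
    using a assms by (simp add: ln_mult ln_div)
  then show ?thesis using a by (simp add: algebra_simps)
qed (use assms in simp)

text \<open>
  Quantitative midpoint convexity of \<open>t * ln t\<close>. The second derivative \<open>1 / t\<close> is not bounded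
  below, so the defect controls \<open>(a - b)\<^sup>2 / (a + b)\<close> rather than \<open>(a - b)\<^sup>2\<close>. The form
  with a free parameter \<open>s\<close> is linear in \<open>\<bar>a - b\<bar>\<close> and \<open>a + b\<close>: it integrates
  directly, and \<open>s\<close> is optimised afterwards, which plays the role of the Cauchy--Schwarz inequality.
  It results from the tangent inequality with \<open>l = 1 + s\<close> at the larger and
  \<open>l = 1 - s\<close> at the smaller value.
\<close>
lemma mult_ln_midpoint:
  fixes a b s :: real
  assumes "0 \<le> a" "0 \<le> b" "0 \<le> s" "s \<le> 1/2"
  shows "s * \<bar>a - b\<bar> - 2 * s\<^sup>2 * (a + b)
      \<le> a * ln a + b * ln b - 2 * ((a + b) / 2 * ln ((a + b) / 2))"
proof -
  have ordered: "s * (a - b) - 2 * s\<^sup>2 * (a + b)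
      \<le> a * ln a + b * ln b - 2 * ((a + b) / 2 * ln ((a + b) / 2))"
    if ab: "0 \<le> a" "0 \<le> b" for a b
  proof (cases "a + b = 0")
    case True
    then have "a = 0" "b = 0" using ab by auto
    then show ?thesis by simp
  next
    case False
    define m where "m = (a + b) / 2"
    have m: "0 < m" "a + b = 2 * m" using False ab by (auto simp: m_def)
    have l1: "s - 2 * s\<^sup>2 \<le> ln (1 + s)"
      using abs_ln_one_plus_x_minus_x_bound[of s] assms by linarith
    have l2: "- s - 2 * s\<^sup>2 \<le> ln (1 - s)"
      using abs_ln_one_plus_x_minus_x_bound[of "- s"] assms by simp
    have "a * ln (1 + s) + a - (1 + s) * m \<le> a * ln a - a * ln m"
      by (rule mult_ln_ge_tangent) (use ab m assms in auto)
    moreover have "b * ln (1 - s) + b - (1 - s) * m \<le> b * ln b - b * ln m"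
      by (rule mult_ln_ge_tangent) (use ab m assms in auto)
    moreover have "a * (s - 2 * s\<^sup>2) \<le> a * ln (1 + s)" "b * (- s - 2 * s\<^sup>2) \<le> b * ln (1 - s)"
      using l1 l2 ab by (auto intro: mult_left_mono)
    moreover have "a * ln m + b * ln m = 2 * (m * ln m)"
      using m(2) by (metis distrib_right mult.assoc)
    moreover have "a * (2 * s\<^sup>2) + b * (2 * s\<^sup>2) = 4 * (m * s\<^sup>2)"
      by (simp add: m_def algebra_simps)
    ultimately show ?thesis
      using m(2) unfolding m_def[symmetric] by (simp add: algebra_simps)
  qed
  show ?thesis
    using ordered[of a b] ordered[of b a] assms by (cases "b \<le> a") (auto simp: add.commute)
qed

lemma mult_ln_ge_minus_one: "- 1 \<le> a * ln a" if "0 \<le> a" for a :: real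
  using mult_ln_ge_tangent[of a 1 1] that by simp

lemma tendsto_mult_ln:
  fixes x :: "'i \<Rightarrow> real"
  assumes lim: "(x \<longlongrightarrow> l) F" and nn: "\<And>i. 0 \<le> x i" and l: "0 \<le> l"
  shows "((\<lambda>i. x i * ln (x i)) \<longlongrightarrow> l * ln l) F"
proof (cases "l = 0")
  case False
  then show ?thesis using lim l by (intro tendsto_intros) auto
next
  case True
  have bound: "\<bar>t * ln t\<bar> \<le> 2 * sqrt t" if t: "0 \<le> t" "t \<le> 1" for t :: real
  proof (cases "t = 0")
    case False
    then have pos: "0 < sqrt t" using t by simp
    have "ln (1 / sqrt t) \<le> 1 / sqrt t - 1" by (rule ln_le_minus_one) (use pos in simp)
    then have "- ln t \<le> 2 / sqrt t"
      using pos t False by (simp add: ln_div ln_sqrt)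
    then have "t * - ln t \<le> t * (2 / sqrt t)" using t by (intro mult_left_mono) auto
    also have "\<dots> = 2 * sqrt t"
      using pos t by (metis mult.commute real_div_sqrt times_divide_eq_left times_divide_eq_right)
    finally show ?thesis using t False by (simp add: abs_mult)
  qed simp
  have sq: "((\<lambda>i. 2 * sqrt (x i)) \<longlongrightarrow> 0) F"
    using tendsto_mult[OF tendsto_const tendsto_real_sqrt[OF lim], of 2] True by simp
  have "\<forall>\<^sub>F i in F. x i < 1" using order_tendstoD(2)[OF lim, of 1] True by simp
  then have "\<forall>\<^sub>F i in F. norm (x i * ln (x i)) \<le> 2 * sqrt (x i)"
    by eventually_elim (use bound nn in auto)
  from Lim_null_comparison[OF this sq] show ?thesis using True by simp
qed

lemma integral_Fatou:
  fixes f :: "nat \<Rightarrow> 'a \<Rightarrow> real"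
  assumes int: "\<And>n. integrable M (f n)" and nn: "\<And>n x. 0 \<le> f n x"
    and lim: "AE x in M. (\<lambda>n. f n x) \<longlonglongrightarrow> g x" and meas: "g \<in> borel_measurable M"
    and bound: "\<forall>\<^sub>F n in sequentially. (\<integral>x. f n x \<partial>M) \<le> b"
  shows "integrable M g" "(\<integral>x. g x \<partial>M) \<le> b"
proof -
  obtain n where "(\<integral>x. f n x \<partial>M) \<le> b" using bound by (auto simp: eventually_sequentially)
  moreover have "0 \<le> (\<integral>x. f n x \<partial>M)" by (simp add: nn)
  ultimately have b: "0 \<le> b" by linarith
  have g0: "AE x in M. 0 \<le> g x"
    using lim by eventually_elim (rule LIMSEQ_le_const, auto simp: nn)
  have "(\<integral>\<^sup>+x. ennreal (g x) \<partial>M) = (\<integral>\<^sup>+x. liminf (\<lambda>n. ennreal (f n x)) \<partial>M)"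
  proof (rule nn_integral_cong_AE)
    show "AE x in M. ennreal (g x) = liminf (\<lambda>n. ennreal (f n x))"
      using lim
    proof eventually_elim
      case (elim x)
      have "(\<lambda>n. ennreal (f n x)) \<longlonglongrightarrow> ennreal (g x)" using elim by (rule tendsto_ennrealI)
      then show ?case by (simp add: lim_imp_Liminf)
    qed
  qed
  also have "\<dots> \<le> liminf (\<lambda>n. \<integral>\<^sup>+x. ennreal (f n x) \<partial>M)"
    by (rule nn_integral_liminf) (use int in auto)
  also have "\<dots> \<le> liminf (\<lambda>n. ennreal b)"
  proof (rule Liminf_mono)
    show "\<forall>\<^sub>F n in sequentially. (\<integral>\<^sup>+x. ennreal (f n x) \<partial>M) \<le> ennreal b"
      using bound
      by eventually_elim (simp add: nn_integral_eq_integral int nn ennreal_leI)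
  qed
  also have "\<dots> = ennreal b" by (simp add: Liminf_const)
  finally have le: "(\<integral>\<^sup>+x. ennreal (g x) \<partial>M) \<le> ennreal b" .
  show int_g: "integrable M g"
    by (rule integrableI_nonneg[OF meas g0]) (use le in \<open>simp add: le_less_trans\<close>)
  show "(\<integral>x. g x \<partial>M) \<le> b"
    using le nn_integral_eq_integral[OF int_g g0] b by simp
qed

text \<open>
  Couplings enter the existence argument only through two properties of their densities, midpoint
  convexity and closedness in \<open>L\<^sup>1\<close>; it is carried out for any set \<open>K\<close> of probability
  densities with these properties that contains one of finite cost and entropy.
\<close>
locale entropic_minimisation = prob_space M
  for M :: "'a measure" +
  fixes c :: "'a \<Rightarrow> real" and k :: real and K :: "('a \<Rightarrow> real) set"
  assumes c_measurable [measurable]: "c \<in> borel_measurable M" and c_ge: "\<And>x. - k \<le> c x"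
    and K_measurable: "\<And>h. h \<in> K \<Longrightarrow> h \<in> borel_measurable M"
    and K_nonneg: "\<And>h x. h \<in> K \<Longrightarrow> 0 \<le> h x"
    and K_integrable: "\<And>h. h \<in> K \<Longrightarrow> integrable M h"
    and K_integral: "\<And>h. h \<in> K \<Longrightarrow> (\<integral>x. h x \<partial>M) = 1"
    and K_midpoint: "\<And>h g. h \<in> K \<Longrightarrow> g \<in> K \<Longrightarrow> (\<lambda>x. (h x + g x) / 2) \<in> K"
    and K_closed: "\<And>h g. (\<And>n. h n \<in> K) \<Longrightarrow> integrable M g \<Longrightarrow> (\<And>x. 0 \<le> g x) \<Longrightarrow>
          (\<lambda>n. \<integral>x. \<bar>h n x - g x\<bar> \<partial>M) \<longlonglongrightarrow> 0 \<Longrightarrow> g \<in> K"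
    and K_finite: "\<exists>h\<in>K. integrable M (\<lambda>x. h x * c x) \<and> integrable M (\<lambda>x. h x * ln (h x))"
begin

definition finite_energy :: "('a \<Rightarrow> real) \<Rightarrow> bool" where
  "finite_energy h \<longleftrightarrow> h \<in> K \<and> integrable M (\<lambda>x. h x * c x) \<and> integrable M (\<lambda>x. h x * ln (h x))"

definition energy :: "real \<Rightarrow> ('a \<Rightarrow> real) \<Rightarrow> real" where
  "energy \<epsilon> h = (\<integral>x. h x * c x + \<epsilon> * (h x * ln (h x)) \<partial>M)"

abbreviation L1_dist :: "('a \<Rightarrow> real) \<Rightarrow> ('a \<Rightarrow> real) \<Rightarrow> real" where
  "L1_dist h g \<equiv> \<integral>x. \<bar>h x - g x\<bar> \<partial>M"

lemma finite_energyD: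
  assumes "finite_energy h"
  shows "h \<in> K" "integrable M (\<lambda>x. h x * c x)" "integrable M (\<lambda>x. h x * ln (h x))"
    and "h \<in> borel_measurable M" "\<And>x. 0 \<le> h x" "integrable M h" "(\<integral>x. h x \<partial>M) = 1"
  using assms K_measurable K_nonneg K_integrable K_integral by (auto simp: finite_energy_def)

lemma finite_energy_midpoint:
  assumes h: "finite_energy h" and g: "finite_energy g"
  shows "finite_energy (\<lambda>x. (h x + g x) / 2)"
proof -
  note [measurable] = finite_energyD(4)[OF h] finite_energyD(4)[OF g]
  have "integrable M (\<lambda>x. (h x * c x + g x * c x) / 2)"
    using finite_energyD(2)[OF h] finite_energyD(2)[OF g] by auto
  then have cost: "integrable M (\<lambda>x. (h x + g x) / 2 * c x)"
    by (simp add: algebra_simps add_divide_distrib)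
  have "integrable M (\<lambda>x. (h x + g x) / 2 * ln ((h x + g x) / 2))"
  proof (rule Bochner_Integration.integrable_bound)
    show "integrable M (\<lambda>x. \<bar>h x * ln (h x)\<bar> + \<bar>g x * ln (g x)\<bar> + 1)"
      using finite_energyD(3)[OF h] finite_energyD(3)[OF g] by auto
    show "AE x in M. norm ((h x + g x) / 2 * ln ((h x + g x) / 2))
        \<le> norm (\<bar>h x * ln (h x)\<bar> + \<bar>g x * ln (g x)\<bar> + 1)"
    proof (rule AE_I2)
      fix x
      have nn: "0 \<le> h x" "0 \<le> g x" using finite_energyD(5) h g by auto
      have "2 * ((h x + g x) / 2 * ln ((h x + g x) / 2)) \<le> h x * ln (h x) + g x * ln (g x)"
        using mult_ln_midpoint[OF nn, of 0] by simp
      moreover have "- 1 \<le> (h x + g x) / 2 * ln ((h x + g x) / 2)"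
        by (rule mult_ln_ge_minus_one) (use nn in simp)
      ultimately show "norm ((h x + g x) / 2 * ln ((h x + g x) / 2))
          \<le> norm (\<bar>h x * ln (h x)\<bar> + \<bar>g x * ln (g x)\<bar> + 1)"
        unfolding real_norm_def by linarith
    qed
  qed measurable
  then show ?thesis
    using cost K_midpoint finite_energyD(1) h g by (simp add: finite_energy_def)
qed

text \<open>
  Strong convexity of the energy with respect to the \<open>L\<^sup>1\<close> distance \<open>T\<close>: a form of Pinsker's
  inequality for the two densities relative to their midpoint.
\<close>
lemma energy_midpoint:
  assumes \<epsilon>: "0 \<le> \<epsilon>" and h: "finite_energy h" and g: "finite_energy g"
  shows "2 * energy \<epsilon> (\<lambda>x. (h x + g x) / 2) + \<epsilon> / 16 * (L1_dist h g)\<^sup>2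
      \<le> energy \<epsilon> h + energy \<epsilon> g"
proof -
  let ?m = "\<lambda>x. (h x + g x) / 2"
  let ?e = "\<lambda>u x. u x * c x + \<epsilon> * (u x * ln (u x))"
  define T where "T = L1_dist h g"
  \<comment> \<open>The maximiser of \<open>s * T - 4 * s\<^sup>2\<close>, with value \<open>T\<^sup>2 / 16\<close>; it is at most
    \<open>1 / 2\<close> because \<open>T \<le> 2\<close>.\<close>
  define s where "s = T / 8"
  have int: "integrable M (?e u)" if "finite_energy u" for u
    using finite_energyD(2,3)[OF that] by auto
  note mid = finite_energy_midpoint[OF h g]
  note hg = finite_energyD(6)[OF h] finite_energyD(6)[OF g]
  have "T \<le> (\<integral>x. h x + g x \<partial>M)"
    unfolding T_def
  proof (rule integral_mono)
    show "\<bar>h x - g x\<bar> \<le> h x + g x" for x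
      using finite_energyD(5)[OF h, of x] finite_energyD(5)[OF g, of x] by linarith
  qed (use hg in auto)
  then have T: "0 \<le> T" "T \<le> 2"
    using hg finite_energyD(7)[OF h] finite_energyD(7)[OF g] by (auto simp: T_def)
  have pt: "2 * ?e ?m x + \<epsilon> * (s * \<bar>h x - g x\<bar> - 2 * s\<^sup>2 * (h x + g x)) \<le> ?e h x + ?e g x" for x
  proof -
    have "\<epsilon> * (s * \<bar>h x - g x\<bar> - 2 * s\<^sup>2 * (h x + g x))
      \<le> \<epsilon> * (h x * ln (h x) + g x * ln (g x) - 2 * (?m x * ln (?m x)))"
      by (intro mult_left_mono[OF _ \<epsilon>] mult_ln_midpoint finite_energyD(5)[OF h] finite_energyD(5)[OF g])
        (use T in \<open>auto simp: s_def\<close>)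
    then show ?thesis by (simp add: algebra_simps add_divide_distrib)
  qed
  define E where "E = ?e ?m"
  have E: "integrable M E" "energy \<epsilon> ?m = (\<integral>x. E x \<partial>M)"
    using int[OF mid] by (simp_all add: E_def energy_def)
  have "2 * energy \<epsilon> ?m + \<epsilon> * (s * T - 2 * s\<^sup>2 * 2)
      = (\<integral>x. 2 * E x + \<epsilon> * (s * \<bar>h x - g x\<bar> - 2 * s\<^sup>2 * (h x + g x)) \<partial>M)"
    using E(1) hg finite_energyD(7)[OF h] finite_energyD(7)[OF g]
    unfolding E(2) T_def by simp
  also have "\<dots> \<le> (\<integral>x. ?e h x + ?e g x \<partial>M)"
  proof (rule integral_mono)
    show "2 * E x + \<epsilon> * (s * \<bar>h x - g x\<bar> - 2 * s\<^sup>2 * (h x + g x)) \<le> ?e h x + ?e g x" for x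
      unfolding E_def by (rule pt)
  qed (use E(1) int[OF h] int[OF g] hg in auto)
  also have "\<dots> = energy \<epsilon> h + energy \<epsilon> g"
    unfolding energy_def using int[OF h] int[OF g] by (rule Bochner_Integration.integral_add)
  finally show ?thesis
    unfolding T_def[symmetric] by (simp add: s_def power2_eq_square algebra_simps)
qed

lemma energy_ge:
  assumes \<epsilon>: "0 \<le> \<epsilon>" and h: "finite_energy h"
  shows "- k - \<epsilon> \<le> energy \<epsilon> h"
proof -
  note D = finite_energyD[OF h]
  have "- k - \<epsilon> = (\<integral>x. - k * h x + - \<epsilon> \<partial>M)" using D(6,7) by (simp add: prob_space)
  also have "\<dots> \<le> energy \<epsilon> h"
    unfolding energy_def
  proof (rule integral_mono)
    fix x
    have "- k * h x \<le> h x * c x"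
      using mult_left_mono[OF c_ge D(5), of x x] by (simp add: mult.commute)
    moreover have "\<epsilon> * - 1 \<le> \<epsilon> * (h x * ln (h x))"
      by (intro mult_left_mono mult_ln_ge_minus_one D(5) \<epsilon>)
    ultimately show "- k * h x + - \<epsilon> \<le> h x * c x + \<epsilon> * (h x * ln (h x))" by linarith
  qed (use D in auto)
  finally show ?thesis .
qed

text \<open>
  Lower semicontinuity. Adding \<open>k * h + \<epsilon>\<close> to the integrand of the energy makes it nonnegative
  and changes its integral by the constant \<open>k + \<epsilon>\<close>, so Fatou's lemma applies. As the
  shifted cost and the shifted entropy are nonnegative separately, finiteness of their sum makes
  each of them integrable.
\<close>
lemma finite_energy_limit:
  assumes \<epsilon>: "0 < \<epsilon>" and h: "\<And>n. finite_energy (h n)"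
    and L1: "(\<lambda>n. L1_dist (h n) u) \<longlonglongrightarrow> 0" and u: "integrable M u" "\<And>x. 0 \<le> u x"
    and ae: "AE x in M. (\<lambda>n. h n x) \<longlonglongrightarrow> u x" and lim: "(\<lambda>n. energy \<epsilon> (h n)) \<longlonglongrightarrow> I"
  shows "finite_energy u" "energy \<epsilon> u \<le> I"
proof -
  have [measurable]: "u \<in> borel_measurable M" using u(1) by simp
  have uK: "u \<in> K" by (rule K_closed[OF finite_energyD(1)[OF h] u L1])
  let ?v = "\<lambda>g x. g x * c x + \<epsilon> * (g x * ln (g x)) + k * g x + \<epsilon>"
  have parts: "0 \<le> g x * (c x + k)" "0 \<le> \<epsilon> * (g x * ln (g x) + 1)" if "\<And>x. 0 \<le> g x" for g :: "'a \<Rightarrow> real" and x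
    using mult_ln_ge_minus_one[OF that, of x] that[of x] c_ge[of x] \<epsilon> by auto
  have v_eq: "?v g x = g x * (c x + k) + \<epsilon> * (g x * ln (g x) + 1)" for g x
    by (simp add: algebra_simps)
  have int: "integrable M (?v (h n))" for n
    using finite_energyD(2,3,6)[OF h[of n]] by auto
  have nn: "0 \<le> ?v (h n) x" for n x
    unfolding v_eq using parts[of "h n", OF finite_energyD(5)[OF h]] by (rule add_nonneg_nonneg)
  have limv: "AE x in M. (\<lambda>n. ?v (h n) x) \<longlonglongrightarrow> ?v u x"
    using ae
  proof eventually_elim
    case (elim x)
    show ?case
      by (intro tendsto_intros tendsto_mult_ln elim finite_energyD(5) h u(2))
  qed
  have integral_v: "(\<integral>x. ?v (h n) x \<partial>M) = energy \<epsilon> (h n) + k + \<epsilon>" for n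
    using finite_energyD(2,3,6,7)[OF h[of n]] by (simp add: energy_def prob_space)
  have bound: "\<forall>\<^sub>F n in sequentially. (\<integral>x. ?v (h n) x \<partial>M) \<le> I + k + \<epsilon> + e" if "e > 0" for e
  proof -
    have "\<forall>\<^sub>F n in sequentially. energy \<epsilon> (h n) < I + e"
      by (rule order_tendstoD(2)[OF lim]) (use that in simp)
    then show ?thesis by eventually_elim (simp add: integral_v)
  qed
  have mv: "?v u \<in> borel_measurable M" by measurable
  note fatou = integral_Fatou[OF int nn limv mv bound]
  have iv: "integrable M (?v u)" by (rule fatou(1)[OF zero_less_one])
  have "integrable M (\<lambda>x. u x * (c x + k))"
    by (rule Bochner_Integration.integrable_bound[OF iv])
      (use parts[of u, OF u(2)] in \<open>auto simp: v_eq\<close>)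
  then have "integrable M (\<lambda>x. u x * (c x + k) - k * u x)" using u(1) by auto
  then have cost: "integrable M (\<lambda>x. u x * c x)" by (simp add: algebra_simps)
  have "integrable M (\<lambda>x. \<epsilon> * (u x * ln (u x) + 1))"
    by (rule Bochner_Integration.integrable_bound[OF iv])
      (use parts[of u, OF u(2)] in \<open>auto simp: v_eq\<close>)
  then have "integrable M (\<lambda>x. u x * ln (u x) + 1)" using \<epsilon> by simp
  from Bochner_Integration.integrable_diff[OF this integrable_const[of 1]]
  have ent: "integrable M (\<lambda>x. u x * ln (u x))" by simp
  show fe: "finite_energy u" using uK cost ent by (simp add: finite_energy_def)
  have "(\<integral>x. ?v u x \<partial>M) = energy \<epsilon> u + k + \<epsilon>"
    using finite_energyD(2,3,6,7)[OF fe] by (simp add: energy_def prob_space)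
  then have "energy \<epsilon> u \<le> I + e" if "e > 0" for e using fatou(2)[OF that] by simp
  then show "energy \<epsilon> u \<le> I" by (rule field_le_epsilon)
qed

lemma L1_complete:
  fixes h :: "nat \<Rightarrow> 'a \<Rightarrow> real"
  assumes int: "\<And>n. integrable M (h n)" and nn: "\<And>n x. 0 \<le> h n x"
    and cauchy: "\<And>e. 0 < e \<Longrightarrow> \<exists>N. \<forall>i\<ge>N. \<forall>j\<ge>N. L1_dist (h i) (h j) < e"
  obtains u r where "strict_mono r" "integrable M u" "\<And>x. 0 \<le> u x"
    "AE x in M. (\<lambda>n. h (r n) x) \<longlonglongrightarrow> u x" "(\<lambda>n. L1_dist (h (r n)) u) \<longlonglongrightarrow> 0"
proof -
  have "\<exists>N. \<forall>i\<ge>N. \<forall>j\<ge>N. (\<integral>x. norm (h i x - h j x) \<partial>M) < e" if "0 < e" for e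
    using cauchy[OF that] by simp
  then obtain r where r: "strict_mono r" and ae: "AE x in M. Cauchy (\<lambda>i. h (r i) x)"
    by (rule cauchy_L1_AE_cauchy_subseq[OF int])
  have [measurable]: "h n \<in> borel_measurable M" for n using int[of n] by simp
  define u where "u x = max 0 (lim (\<lambda>i. h (r i) x))" for x
  have [measurable]: "u \<in> borel_measurable M" unfolding u_def by measurable
  have lim: "AE x in M. (\<lambda>n. h (r n) x) \<longlonglongrightarrow> u x"
    using ae
  proof eventually_elim
    case (elim x)
    then have L: "(\<lambda>i. h (r i) x) \<longlonglongrightarrow> lim (\<lambda>i. h (r i) x)"
      using Cauchy_convergent convergent_LIMSEQ_iff by blast
    then have "0 \<le> lim (\<lambda>i. h (r i) x)" by (rule LIMSEQ_le_const) (auto simp: nn)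
    then show ?case using L by (simp add: u_def)
  qed
  have tail: "integrable M (\<lambda>x. \<bar>h (r n) x - u x\<bar>) \<and> L1_dist (h (r n)) u \<le> e"
    if N: "\<forall>i\<ge>N. \<forall>j\<ge>N. L1_dist (h i) (h j) < e" and n: "n \<ge> N" for n N e
  proof -
    have ge: "N \<le> r m" if "m \<ge> N" for m using seq_suble[OF r, of m] that by linarith
    have 1: "integrable M (\<lambda>x. \<bar>h (r n) x - h (r m) x\<bar>)" for m using int by auto
    have 2: "AE x in M. (\<lambda>m. \<bar>h (r n) x - h (r m) x\<bar>) \<longlonglongrightarrow> \<bar>h (r n) x - u x\<bar>"
      using lim by eventually_elim (intro tendsto_intros)
    have 3: "(\<lambda>x. \<bar>h (r n) x - u x\<bar>) \<in> borel_measurable M" by measurable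
    have "\<forall>\<^sub>F m in sequentially. L1_dist (h (r n)) (h (r m)) \<le> e"
      unfolding eventually_sequentially using N ge n less_imp_le by meson
    from integral_Fatou[OF 1 _ 2 3 this] show ?thesis by simp
  qed
  have "integrable M u"
  proof -
    obtain N where "\<forall>i\<ge>N. \<forall>j\<ge>N. L1_dist (h i) (h j) < 1" using cauchy[of 1] by auto
    then have "integrable M (\<lambda>x. \<bar>h (r N) x - u x\<bar>)" using tail by blast
    then have "integrable M (\<lambda>x. h (r N) x - u x)"
      by (subst (asm) integrable_abs_iff) auto
    then have "integrable M (\<lambda>x. h (r N) x - (h (r N) x - u x))"
      by (rule Bochner_Integration.integrable_diff[OF int])
    then show ?thesis by (simp add: algebra_simps)
  qed
  moreover have "(\<lambda>n. L1_dist (h (r n)) u) \<longlonglongrightarrow> 0"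
  proof (rule LIMSEQ_I)
    fix e :: real assume "e > 0"
    then obtain N where "\<forall>i\<ge>N. \<forall>j\<ge>N. L1_dist (h i) (h j) < e / 2" using cauchy[of "e/2"] by auto
    then have "\<forall>n\<ge>N. L1_dist (h (r n)) u \<le> e / 2" using tail by blast
    then have "\<forall>n\<ge>N. norm (L1_dist (h (r n)) u - 0) < e" using \<open>e > 0\<close> by fastforce
    then show "\<exists>N. \<forall>n\<ge>N. norm (L1_dist (h (r n)) u - 0) < e" by blast
  qed
  moreover have "0 \<le> u x" for x by (simp add: u_def)
  ultimately show ?thesis using that r lim by blast
qed

text \<open>
  By strong convexity a minimising sequence is Cauchy in \<open>L\<^sup>1\<close>, so the minimiser exists by
  completeness of \<open>L\<^sup>1\<close>, without compactness of the set of couplings. Applied once more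
  to the minimiser and an arbitrary competitor, strong convexity yields quadratic growth,
  and in particular uniqueness.
\<close>
proposition minimiser_exists:
  assumes \<epsilon>: "0 < \<epsilon>"
  obtains h where "finite_energy h"
    "\<And>g. finite_energy g \<Longrightarrow> energy \<epsilon> h + \<epsilon> / 16 * (L1_dist g h)\<^sup>2 \<le> energy \<epsilon> g"
proof -
  define I where "I = (INF h\<in>{h. finite_energy h}. energy \<epsilon> h)"
  have ne: "{h. finite_energy h} \<noteq> {}" using K_finite by (auto simp: finite_energy_def)
  have bdd: "bdd_below (energy \<epsilon> ` {h. finite_energy h})"
    by (rule bdd_belowI2[of _ "- k - \<epsilon>"]) (use energy_ge \<epsilon> in auto)
  have I_le: "I \<le> energy \<epsilon> h" if "finite_energy h" for h
    unfolding I_def using that by (intro cINF_lower[OF bdd]) auto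
  have "\<exists>h. finite_energy h \<and> energy \<epsilon> h < I + 1 / real (Suc n)" for n
    using cINF_less_iff[OF ne bdd, of "I + 1 / real (Suc n)"] by (auto simp: I_def)
  then obtain h where h: "\<And>n. finite_energy (h n)"
    and hI: "\<And>n. energy \<epsilon> (h n) < I + 1 / real (Suc n)" by metis
  have inv0: "(\<lambda>n. 1 / real (Suc n)) \<longlonglongrightarrow> 0"
    using LIMSEQ_Suc[OF lim_1_over_n[where 'a = real]] by simp
  have lim: "(\<lambda>n. energy \<epsilon> (h n)) \<longlonglongrightarrow> I"
  proof (rule tendsto_sandwich[OF _ _ tendsto_const])
    show "(\<lambda>n. I + 1 / real (Suc n)) \<longlonglongrightarrow> I" using tendsto_add[OF tendsto_const inv0] by simp
  qed (intro always_eventually allI less_imp_le[OF hI] I_le[OF h])+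
  have dist: "\<epsilon> / 16 * (L1_dist (h i) (h j))\<^sup>2 \<le> energy \<epsilon> (h i) + energy \<epsilon> (h j) - 2 * I" for i j
    using energy_midpoint[OF less_imp_le[OF \<epsilon>] h h, of i j]
      I_le[OF finite_energy_midpoint[OF h h], of i j] by linarith
  have cauchy: "\<exists>N. \<forall>i\<ge>N. \<forall>j\<ge>N. L1_dist (h i) (h j) < e" if e: "0 < e" for e
  proof -
    have "\<forall>\<^sub>F n in sequentially. energy \<epsilon> (h n) < I + \<epsilon> * e\<^sup>2 / 32"
      by (rule order_tendstoD(2)[OF lim]) (use e \<epsilon> in simp)
    then obtain N where N: "\<And>n. n \<ge> N \<Longrightarrow> energy \<epsilon> (h n) < I + \<epsilon> * e\<^sup>2 / 32"
      by (auto simp: eventually_sequentially)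
    have "L1_dist (h i) (h j) < e" if "i \<ge> N" "j \<ge> N" for i j
    proof -
      have "\<epsilon> / 16 * (L1_dist (h i) (h j))\<^sup>2 < \<epsilon> / 16 * e\<^sup>2"
        using dist[of i j] N[OF that(1)] N[OF that(2)] by (simp add: field_simps)
      then have "(L1_dist (h i) (h j))\<^sup>2 < e\<^sup>2" using \<epsilon> by simp
      then show ?thesis using e by (rule power2_less_imp_less[OF _ less_imp_le])
    qed
    then show ?thesis by blast
  qed
  obtain u r where r: "strict_mono r" and u: "integrable M u" "\<And>x. 0 \<le> u x"
    "AE x in M. (\<lambda>n. h (r n) x) \<longlonglongrightarrow> u x" "(\<lambda>n. L1_dist (h (r n)) u) \<longlonglongrightarrow> 0"
    by (rule L1_complete[OF finite_energyD(6)[OF h] finite_energyD(5)[OF h] cauchy]) blast+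
  have lim_r: "(\<lambda>n. energy \<epsilon> (h (r n))) \<longlonglongrightarrow> I"
    using LIMSEQ_subseq_LIMSEQ[OF lim r] by (simp add: o_def)
  note fe = finite_energy_limit[OF \<epsilon> h u(4,1,2,3) lim_r]
  show ?thesis
  proof (rule that[OF fe(1)])
    fix g assume g: "finite_energy g"
    show "energy \<epsilon> u + \<epsilon> / 16 * (L1_dist g u)\<^sup>2 \<le> energy \<epsilon> g"
      using energy_midpoint[OF less_imp_le[OF \<epsilon>] g fe(1)]
        I_le[OF finite_energy_midpoint[OF g fe(1)]] fe(2) by linarith
  qed
qed

end

section \<open>Extended integrals and relative entropy of densities\<close>

lemma ext_integral_eq_integral:
  assumes "integrable M f"
  shows "ext_integral M f = ereal (\<integral>x. f x \<partial>M)"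
proof -
  have "(\<integral>\<^sup>+x. ennreal (f x) \<partial>M) \<noteq> \<infinity>" "(\<integral>\<^sup>+x. ennreal (- f x) \<partial>M) \<noteq> \<infinity>"
    using assms by (auto simp: real_integrable_def)
  then show ?thesis
    unfolding ext_integral_def real_lebesgue_integral_def[OF assms]
    by (cases "\<integral>\<^sup>+x. ennreal (f x) \<partial>M"; cases "\<integral>\<^sup>+x. ennreal (- f x) \<partial>M")
      (auto simp: enn2ereal_ennreal)
qed

text \<open>
  An integrable minorant makes the negative part finite, so non-integrability can only come
  from the positive part.
\<close>
lemma ext_integral_eq_infinity:
  assumes "f \<in> borel_measurable M" "integrable M g" "\<And>x. x \<in> space M \<Longrightarrow> g x \<le> f x"
    and "\<not> integrable M f"
  shows "ext_integral M f = \<infinity>"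
proof -
  have "(\<integral>\<^sup>+x. ennreal (- f x) \<partial>M) \<le> (\<integral>\<^sup>+x. ennreal (- g x) \<partial>M)"
    using assms(3) by (intro nn_integral_mono ennreal_leI) auto
  also have "\<dots> < \<infinity>" using assms(2) by (auto simp: real_integrable_def less_top)
  finally have neg: "(\<integral>\<^sup>+x. ennreal (- f x) \<partial>M) \<noteq> \<infinity>" by auto
  then have "(\<integral>\<^sup>+x. ennreal (f x) \<partial>M) = \<infinity>"
    using assms(1,4) by (auto simp: real_integrable_def)
  then show ?thesis
    unfolding ext_integral_def using neg by (cases "\<integral>\<^sup>+x. ennreal (- f x) \<partial>M") (auto simp: enn2ereal_ennreal)
qed

lemma ext_integral_density:
  fixes h f :: "'a \<Rightarrow> real"
  assumes [measurable]: "h \<in> borel_measurable M" "f \<in> borel_measurable M" and h: "\<And>x. 0 \<le> h x"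
  shows "ext_integral (density M (\<lambda>x. ennreal (h x))) f = ext_integral M (\<lambda>x. h x * f x)"
proof -
  have "(\<integral>\<^sup>+x. ennreal (g x) \<partial>density M (\<lambda>x. ennreal (h x))) = (\<integral>\<^sup>+x. ennreal (h x * g x) \<partial>M)"
    if "g \<in> borel_measurable M" for g :: "'a \<Rightarrow> real"
    using that by (subst nn_integral_density) (auto simp: ennreal_mult' h)
  from this[of f] this[of "\<lambda>x. - f x"] show ?thesis
    by (simp add: ext_integral_def)
qed

lemma ext_integral_cong_AE:
  assumes "AE x in M. f x = g x"
  shows "ext_integral M f = ext_integral M g"
proof -
  have "(\<integral>\<^sup>+x. ennreal (f x) \<partial>M) = (\<integral>\<^sup>+x. ennreal (g x) \<partial>M)"
    "(\<integral>\<^sup>+x. ennreal (- f x) \<partial>M) = (\<integral>\<^sup>+x. ennreal (- g x) \<partial>M)"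
    using assms by (auto intro!: nn_integral_cong_AE)
  then show ?thesis by (simp add: ext_integral_def)
qed

lemma (in sigma_finite_measure) KL_density_eq:
  fixes h :: "'a \<Rightarrow> real"
  assumes [measurable]: "h \<in> borel_measurable M" and h: "\<And>x. 0 \<le> h x"
  shows "KL (density M (\<lambda>x. ennreal (h x))) M = ext_integral M (\<lambda>x. h x * ln (h x))"
proof -
  let ?P = "density M (\<lambda>x. ennreal (h x))"
  have "AE x in M. ennreal (h x) = RN_deriv M ?P x"
    by (rule RN_deriv_unique) auto
  then have ae: "AE x in M. enn2real (RN_deriv M ?P x) = h x"
    by eventually_elim (metis h enn2real_ennreal)
  have "KL ?P M = ext_integral ?P (\<lambda>x. ln (enn2real (RN_deriv M ?P x)))"
    by (simp add: KL_def absolutely_continuousI_density)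
  also have "\<dots> = ext_integral M (\<lambda>x. h x * ln (enn2real (RN_deriv M ?P x)))"
    by (rule ext_integral_density) (auto simp: h)
  also have "\<dots> = ext_integral M (\<lambda>x. h x * ln (h x))"
    using ae by (intro ext_integral_cong_AE) auto
  finally show ?thesis .
qed

section \<open>Entropic optimal transport\<close>

locale entropic_transport =
  fixes \<mu> :: "'a::second_countable_topology measure" and \<nu> :: "'b::second_countable_topology measure"
    and C :: "'a \<times> 'b \<Rightarrow> real" and k :: real
  assumes prob_\<mu>: "prob_space \<mu>" and sets_\<mu>: "sets \<mu> = sets borel"
    and prob_\<nu>: "prob_space \<nu>" and sets_\<nu>: "sets \<nu> = sets borel"
    and C_borel: "C \<in> borel_measurable borel" and C_ge: "\<And>z. - k \<le> C z"
    and C_integrable: "integrable (\<mu> \<Otimes>\<^sub>M \<nu>) C"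
begin

abbreviation M :: "('a \<times> 'b) measure" where "M \<equiv> \<mu> \<Otimes>\<^sub>M \<nu>"

sublocale \<mu>: prob_space \<mu> by (rule prob_\<mu>)
sublocale \<nu>: prob_space \<nu> by (rule prob_\<nu>)
sublocale pair_prob_space \<mu> \<nu> ..

lemma sets_M: "sets M = sets borel"
  unfolding borel_prod[symmetric] by (rule sets_pair_measure_cong[OF sets_\<mu> sets_\<nu>])

lemma space_M: "space M = UNIV"
  using sets_eq_imp_space_eq[OF sets_M] by simp

lemma space_\<mu>: "space \<mu> = UNIV" and space_\<nu>: "space \<nu> = UNIV"
  using sets_eq_imp_space_eq[OF sets_\<mu>] sets_eq_imp_space_eq[OF sets_\<nu>] by simp_all

lemma measurable_M_iff: "f \<in> borel_measurable M \<longleftrightarrow> f \<in> borel_measurable borel"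
  by (rule arg_cong[of _ _ "\<lambda>S. f \<in> S"]) (rule measurable_cong_sets[OF sets_M refl])

definition density_measure :: "('a \<times> 'b \<Rightarrow> real) \<Rightarrow> ('a \<times> 'b) measure" where
  "density_measure h = density M (\<lambda>z. ennreal (h z))"

definition coupling_densities :: "('a \<times> 'b \<Rightarrow> real) set" where
  "coupling_densities = {h \<in> borel_measurable M. (\<forall>z. 0 \<le> h z) \<and> density_measure h \<in> couplings \<mu> \<nu>}"

lemma sets_density_measure: "sets (density_measure h) = sets borel"
  by (simp add: density_measure_def sets_M)

lemma fst_measurable: "fst \<in> measurable P (borel :: 'a measure)"
  and snd_measurable: "snd \<in> measurable P (borel :: 'b measure)"
  if "sets P = sets borel" for P :: "('a \<times> 'b) measure"
proof -
  have "fst \<in> borel_measurable (borel :: ('a \<times> 'b) measure)"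
    "snd \<in> borel_measurable (borel :: ('a \<times> 'b) measure)"
    by (intro borel_measurable_continuous_onI continuous_intros)+
  then show "fst \<in> measurable P (borel :: 'a measure)" "snd \<in> measurable P (borel :: 'b measure)"
    using that by (simp_all cong: measurable_cong_sets)
qed

lemma cylinder_sets: "A \<in> sets borel \<Longrightarrow> fst -` A \<in> sets M" "B \<in> sets borel \<Longrightarrow> snd -` B \<in> sets M"
  using measurable_sets[OF fst_measurable[OF sets_M], of A]
    measurable_sets[OF snd_measurable[OF sets_M], of B] by (simp_all add: space_M)

lemma emeasure_density_measure:
  assumes int: "integrable M h" and nn: "\<And>z. 0 \<le> h z" and S: "S \<in> sets M"
  shows "emeasure (density_measure h) S = ennreal (\<integral>z. h z * indicator S z \<partial>M)"
proof -
  have "emeasure (density_measure h) S = (\<integral>\<^sup>+z. ennreal (h z * indicator S z) \<partial>M)"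
    unfolding density_measure_def using borel_measurable_integrable[OF int] S
    by (subst emeasure_density) (auto simp: nn intro!: nn_integral_cong split: split_indicator)
  also have "\<dots> = ennreal (\<integral>z. h z * indicator S z \<partial>M)"
    by (rule nn_integral_eq_integral)
      (use integrable_mult_indicator[OF S int] nn in \<open>auto simp: mult.commute\<close>)
  finally show ?thesis .
qed

text \<open>
  For a density, having the prescribed marginals is a family of affine constraints
  \<open>\<integral> h * indicator S = v\<close>, one for each cylinder \<open>S\<close>. This form makes convexity
  and closedness in \<open>L\<^sup>1\<close> evident.
\<close>
lemma coupling_densitiesI:
  assumes int: "integrable M h" and nn: "\<And>z. 0 \<le> h z"
    and fst: "\<And>A. A \<in> sets borel \<Longrightarrow> (\<integral>z. h z * indicator (fst -` A) z \<partial>M) = measure \<mu> A"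
    and snd: "\<And>B. B \<in> sets borel \<Longrightarrow> (\<integral>z. h z * indicator (snd -` B) z \<partial>M) = measure \<nu> B"
  shows "h \<in> coupling_densities"
proof -
  let ?P = "density_measure h"
  have meas: "h \<in> borel_measurable M" using int by simp
  note emeas = emeasure_density_measure[OF int nn]
  have "distr ?P borel fst = \<mu>"
  proof (rule measure_eqI)
    fix A :: "'a set" assume "A \<in> sets (distr ?P borel fst)"
    then have A: "A \<in> sets borel" by simp
    then show "emeasure (distr ?P borel fst) A = emeasure \<mu> A"
      using fst_measurable[OF sets_density_measure, of h] sets_eq_imp_space_eq[OF sets_density_measure, of h]
      by (subst emeasure_distr) (simp_all add: emeas cylinder_sets fst \<mu>.emeasure_eq_measure)
  qed (simp add: sets_\<mu>)
  moreover have "distr ?P borel snd = \<nu>"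
  proof (rule measure_eqI)
    fix B :: "'b set" assume "B \<in> sets (distr ?P borel snd)"
    then have B: "B \<in> sets borel" by simp
    then show "emeasure (distr ?P borel snd) B = emeasure \<nu> B"
      using snd_measurable[OF sets_density_measure, of h] sets_eq_imp_space_eq[OF sets_density_measure, of h]
      by (subst emeasure_distr) (simp_all add: emeas cylinder_sets snd \<nu>.emeasure_eq_measure)
  qed (simp add: sets_\<nu>)
  moreover have "prob_space ?P"
  proof (rule prob_spaceI)
    have "emeasure ?P UNIV = ennreal (measure \<mu> UNIV)"
      using emeas[of UNIV] fst[of UNIV] sets_M by simp
    then show "emeasure ?P (space ?P) = 1"
      using \<mu>.prob_space sets_eq_imp_space_eq[OF sets_density_measure, of h] by (simp add: space_\<mu>)
  qed
  ultimately show ?thesis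
    by (simp add: coupling_densities_def couplings_def sets_density_measure meas nn)
qed

lemma coupling_densitiesD:
  assumes "h \<in> coupling_densities"
  shows "h \<in> borel_measurable M" "\<And>z. 0 \<le> h z" "density_measure h \<in> couplings \<mu> \<nu>"
    and "integrable M h" "(\<integral>z. h z \<partial>M) = 1"
    and "\<And>A. A \<in> sets borel \<Longrightarrow> (\<integral>z. h z * indicator (fst -` A) z \<partial>M) = measure \<mu> A"
    and "\<And>B. B \<in> sets borel \<Longrightarrow> (\<integral>z. h z * indicator (snd -` B) z \<partial>M) = measure \<nu> B"
proof -
  let ?P = "density_measure h"
  show meas: "h \<in> borel_measurable M" and nn: "0 \<le> h z" and P: "?P \<in> couplings \<mu> \<nu>" for z
    using assms unfolding coupling_densities_def by blast+
  interpret Q: prob_space ?P using P by (simp add: couplings_def)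
  have "(\<integral>\<^sup>+z. ennreal (h z) \<partial>M) = emeasure ?P (space M)"
    unfolding density_measure_def using meas
    by (subst emeasure_density) (auto intro!: nn_integral_cong)
  also have "\<dots> = 1" using Q.emeasure_space_1 by (simp add: density_measure_def)
  finally have one: "(\<integral>\<^sup>+z. ennreal (h z) \<partial>M) = 1" .
  then show int: "integrable M h"
    by (intro integrableI_nonneg[OF meas]) (auto simp: nn)
  have meas_P: "measure ?P S = (\<integral>z. h z * indicator S z \<partial>M)" if "S \<in> sets M" for S
    using emeasure_density_measure[OF int nn that]
    by (intro measure_eq_emeasure_eq_ennreal) (simp_all add: nn)
  show "(\<integral>z. h z \<partial>M) = 1"
    using nn_integral_eq_integral[OF int] nn one by simp
  have sp: "space ?P = UNIV" using sets_eq_imp_space_eq[OF sets_density_measure, of h] by simp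
  show "(\<integral>z. h z * indicator (fst -` A) z \<partial>M) = measure \<mu> A" if "A \<in> sets borel" for A
  proof -
    have "measure (distr ?P borel fst) A = measure ?P (fst -` A)"
      using measure_distr[OF fst_measurable[OF sets_density_measure] that, of h] sp by simp
    then show ?thesis using P meas_P[OF cylinder_sets(1)[OF that]] by (simp add: couplings_def)
  qed
  show "(\<integral>z. h z * indicator (snd -` B) z \<partial>M) = measure \<nu> B" if "B \<in> sets borel" for B
  proof -
    have "measure (distr ?P borel snd) B = measure ?P (snd -` B)"
      using measure_distr[OF snd_measurable[OF sets_density_measure] that, of h] sp by simp
    then show ?thesis using P meas_P[OF cylinder_sets(2)[OF that]] by (simp add: couplings_def)
  qed
qed

lemma integral_midpoint_indicator:
  fixes h g :: "'a \<times> 'b \<Rightarrow> real"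
  assumes "integrable M h" "integrable M g" "S \<in> sets M"
    and "(\<integral>z. h z * indicator S z \<partial>M) = v" "(\<integral>z. g z * indicator S z \<partial>M) = v"
  shows "(\<integral>z. (h z + g z) / 2 * indicator S z \<partial>M) = v"
proof -
  have "integrable M (\<lambda>z. h z * indicator S z)" "integrable M (\<lambda>z. g z * indicator S z)"
    using integrable_mult_indicator[OF assms(3,1)] integrable_mult_indicator[OF assms(3,2)]
    by (simp_all add: mult.commute)
  then have "(\<integral>z. (h z * indicator S z + g z * indicator S z) / 2 \<partial>M) = v"
    using assms(4,5) by simp
  then show ?thesis by (simp add: algebra_simps add_divide_distrib)
qed

lemma integral_limit_indicator:
  fixes h :: "nat \<Rightarrow> 'a \<times> 'b \<Rightarrow> real"
  assumes h: "\<And>n. integrable M (h n)" and g: "integrable M g" and S: "S \<in> sets M"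
    and v: "\<And>n. (\<integral>z. h n z * indicator S z \<partial>M) = v"
    and lim: "(\<lambda>n. \<integral>z. \<bar>h n z - g z\<bar> \<partial>M) \<longlonglongrightarrow> 0"
  shows "(\<integral>z. g z * indicator S z \<partial>M) = v"
proof -
  have ih: "integrable M (\<lambda>z. h n z * indicator S z)" for n
    using integrable_mult_indicator[OF S h] by (simp add: mult.commute)
  have ig: "integrable M (\<lambda>z. g z * indicator S z)"
    using integrable_mult_indicator[OF S g] by (simp add: mult.commute)
  have "\<bar>v - (\<integral>z. g z * indicator S z \<partial>M)\<bar> \<le> (\<integral>z. \<bar>h n z - g z\<bar> \<partial>M)" for n
  proof -
    have "v - (\<integral>z. g z * indicator S z \<partial>M)
        = (\<integral>z. h n z * indicator S z - g z * indicator S z \<partial>M)"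
      using v[of n] ih ig by simp
    also have "\<bar>\<dots>\<bar> \<le> (\<integral>z. \<bar>h n z - g z\<bar> \<partial>M)"
      using ih ig h g
      by (intro order_trans[OF integral_abs_bound] integral_mono) (auto split: split_indicator)
    finally show ?thesis .
  qed
  then have "\<bar>v - (\<integral>z. g z * indicator S z \<partial>M)\<bar> \<le> 0"
    using LIMSEQ_le_const[OF lim] by blast
  then show ?thesis by simp
qed

lemma one_coupling_density: "(\<lambda>_. 1) \<in> coupling_densities"
proof (rule coupling_densitiesI)
  show "(\<integral>z. 1 * indicator (fst -` A) z \<partial>M) = measure \<mu> A" if "A \<in> sets borel" for A :: "'a set"
  proof -
    have "fst -` A = A \<times> space \<nu>" by (auto simp: space_\<nu>)
    then show ?thesis
      using that \<nu>.emeasure_space_1 \<nu>.emeasure_pair_measure_Times[of A \<mu> "space \<nu>"]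
      by (simp add: space_M measure_def sets_\<mu>)
  qed
  show "(\<integral>z. 1 * indicator (snd -` B) z \<partial>M) = measure \<nu> B" if "B \<in> sets borel" for B :: "'b set"
  proof -
    have "snd -` B = space \<mu> \<times> B" by (auto simp: space_\<mu>)
    then show ?thesis
      using that \<mu>.emeasure_space_1 \<nu>.emeasure_pair_measure_Times[of "space \<mu>" \<mu> B]
      by (simp add: space_M measure_def sets_\<nu>)
  qed
qed auto

sublocale entropic_minimisation M C k coupling_densities
proof unfold_locales
  show "C \<in> borel_measurable M" using C_integrable by simp
  show "- k \<le> C z" for z by (rule C_ge)
  show "\<exists>h\<in>coupling_densities. integrable M (\<lambda>x. h x * C x) \<and> integrable M (\<lambda>x. h x * ln (h x))"
    using one_coupling_density C_integrable by (intro bexI[of _ "\<lambda>_. 1"]) auto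
  show "(\<lambda>z. (h z + g z) / 2) \<in> coupling_densities"
    if "h \<in> coupling_densities" "g \<in> coupling_densities" for h g
    using coupling_densitiesD[OF that(1)] coupling_densitiesD[OF that(2)]
    by (intro coupling_densitiesI integral_midpoint_indicator cylinder_sets) auto
  show "g \<in> coupling_densities"
    if h: "\<And>n. h n \<in> coupling_densities" and g: "integrable M g" "\<And>x. 0 \<le> g x"
      and lim: "(\<lambda>n. \<integral>x. \<bar>h n x - g x\<bar> \<partial>M) \<longlonglongrightarrow> 0" for h g
  proof (rule coupling_densitiesI[OF g])
    note D = coupling_densitiesD[OF h]
    show "(\<integral>z. g z * indicator (fst -` A) z \<partial>M) = measure \<mu> A" if "A \<in> sets borel" for A
      by (rule integral_limit_indicator[OF D(4) g(1) cylinder_sets(1)[OF that] D(6)[OF that] lim])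
    show "(\<integral>z. g z * indicator (snd -` B) z \<partial>M) = measure \<nu> B" if "B \<in> sets borel" for B
      by (rule integral_limit_indicator[OF D(4) g(1) cylinder_sets(2)[OF that] D(7)[OF that] lim])
  qed
qed (use coupling_densitiesD in auto)

lemma entropic_cost_density:
  assumes h: "h \<in> coupling_densities" and \<epsilon>: "0 < \<epsilon>"
  shows "entropic_cost \<mu> \<nu> C \<epsilon> (density_measure h) = (if finite_energy h then ereal (energy \<epsilon> h) else \<infinity>)"
proof -
  note D = coupling_densitiesD[OF h]
  note [measurable] = D(1)
  have cost: "transport_cost C (density_measure h) = ext_integral M (\<lambda>z. h z * C z)"
    unfolding transport_cost_def density_measure_def by (rule ext_integral_density) (auto simp: D(2))
  have ent: "coupling_entropy \<mu> \<nu> (density_measure h) = ext_integral M (\<lambda>z. h z * ln (h z))"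
    unfolding coupling_entropy_def density_measure_def by (rule KL_density_eq) (auto simp: D(2))
  have cost_inf: "ext_integral M (\<lambda>z. h z * C z) = \<infinity>" if "\<not> integrable M (\<lambda>z. h z * C z)"
  proof (rule ext_integral_eq_infinity[OF _ _ _ that])
    show "integrable M (\<lambda>z. - k * h z)" using D(4) by simp
    show "- k * h z \<le> h z * C z" for z
      using mult_left_mono[OF C_ge D(2), of z z] by (simp add: mult.commute)
  qed auto
  have ent_inf: "ext_integral M (\<lambda>z. h z * ln (h z)) = \<infinity>" if "\<not> integrable M (\<lambda>z. h z * ln (h z))"
    by (rule ext_integral_eq_infinity[OF _ _ _ that, of "\<lambda>_. - 1"])
      (auto intro: mult_ln_ge_minus_one D(2))
  show ?thesis
    using h \<epsilon> cost_inf ent_inf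
    unfolding entropic_cost_def cost ent finite_energy_def energy_def
    by (cases "integrable M (\<lambda>z. h z * C z)"; cases "integrable M (\<lambda>z. h z * ln (h z))")
      (auto simp: ext_integral_eq_integral)
qed

text \<open>
  Couplings without a density of finite energy have infinite entropic cost, hence the
  minimisation over measures is the one over densities.
\<close>
lemma coupling_entropic_cost_cases:
  assumes \<pi>: "\<pi> \<in> couplings \<mu> \<nu>" and \<epsilon>: "0 < \<epsilon>"
  obtains h where "finite_energy h" "\<pi> = density_measure h"
      "entropic_cost \<mu> \<nu> C \<epsilon> \<pi> = ereal (energy \<epsilon> h)"
  | "entropic_cost \<mu> \<nu> C \<epsilon> \<pi> = \<infinity>"
proof (cases "absolutely_continuous M \<pi>")
  case True
  have \<pi>': "prob_space \<pi>" "sets \<pi> = sets M" using \<pi> by (auto simp: couplings_def sets_M)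
  interpret \<pi>: prob_space \<pi> by fact
  obtain h where h: "h \<in> borel_measurable M" "AE z in M. RN_deriv M \<pi> z = ennreal (h z)"
      "\<And>z. 0 \<le> h z"
    using real_RN_deriv[OF \<pi>.finite_measure_axioms True \<pi>'(2)] by metis
  have "\<pi> = density M (RN_deriv M \<pi>)" by (simp add: density_RN_deriv[OF True \<pi>'(2)])
  also have "\<dots> = density_measure h"
    unfolding density_measure_def using h by (intro density_cong) auto
  finally have eq: "\<pi> = density_measure h" .
  then have "h \<in> coupling_densities" using \<pi> h by (auto simp: coupling_densities_def)
  from entropic_cost_density[OF this \<epsilon>] show ?thesis using that eq by (auto split: if_splits)
next
  case False
  then have "coupling_entropy \<mu> \<nu> \<pi> = \<infinity>" by (simp add: coupling_entropy_def KL_def)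
  then show ?thesis using that \<epsilon> by (simp add: entropic_cost_def)
qed

text \<open>
  The minimiser over densities is the unique minimiser over all couplings, hence the plan defined
  by unique description: by quadratic growth, another minimiser has \<open>L\<^sup>1\<close> distance \<open>0\<close>
  to it.
\<close>
lemma entropic_plan_density:
  assumes \<epsilon>: "0 < \<epsilon>"
  obtains h where "finite_energy h" "entropic_plan \<mu> \<nu> C \<epsilon> = density_measure h"
    "\<And>g. finite_energy g \<Longrightarrow> energy \<epsilon> h + \<epsilon> / 16 * (L1_dist g h)\<^sup>2 \<le> energy \<epsilon> g"
proof -
  obtain h where h: "finite_energy h"
    and min: "\<And>g. finite_energy g \<Longrightarrow> energy \<epsilon> h + \<epsilon> / 16 * (L1_dist g h)\<^sup>2 \<le> energy \<epsilon> g"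
    by (rule minimiser_exists[OF \<epsilon>]) blast
  let ?F = "entropic_cost \<mu> \<nu> C \<epsilon>"
  have Fh: "?F (density_measure h) = ereal (energy \<epsilon> h)"
    using entropic_cost_density[OF finite_energyD(1)[OF h] \<epsilon>] h by simp
  have hc: "density_measure h \<in> couplings \<mu> \<nu>"
    using coupling_densitiesD(3) finite_energyD(1) h by blast
  have le: "?F (density_measure h) \<le> ?F \<pi>" if "\<pi> \<in> couplings \<mu> \<nu>" for \<pi>
  proof (cases rule: coupling_entropic_cost_cases[OF that \<epsilon>, case_names density infinite])
    case (density g)
    have "0 \<le> \<epsilon> / 16 * (L1_dist g h)\<^sup>2" using \<epsilon> by simp
    with min[OF density(1)] have "energy \<epsilon> h \<le> energy \<epsilon> g" by linarith
    then show ?thesis using density Fh by simp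
  qed simp
  have "entropic_plan \<mu> \<nu> C \<epsilon> = density_measure h"
    unfolding entropic_plan_def
  proof (rule the_equality)
    show "is_arg_min ?F (\<lambda>\<pi>. \<pi> \<in> couplings \<mu> \<nu>) (density_measure h)"
      unfolding is_arg_min_def using hc le by (auto simp: not_less)
  next
    fix \<pi> assume "is_arg_min ?F (\<lambda>\<pi>. \<pi> \<in> couplings \<mu> \<nu>) \<pi>"
    then have \<pi>: "\<pi> \<in> couplings \<mu> \<nu>" "?F \<pi> \<le> ?F (density_measure h)"
      unfolding is_arg_min_def using hc by (auto simp: not_less)
    from \<pi>(1) \<epsilon> show "\<pi> = density_measure h"
    proof (cases rule: coupling_entropic_cost_cases[case_names density infinite])
      case (density g)
      have "energy \<epsilon> g \<le> energy \<epsilon> h" using \<pi>(2) density Fh by simp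
      with min[OF density(1)] have "\<epsilon> / 16 * (L1_dist g h)\<^sup>2 \<le> 0" by linarith
      then have L0: "L1_dist g h = 0" using \<epsilon> by (simp add: mult_le_0_iff)
      have "AE z in M. \<bar>g z - h z\<bar> = 0"
        using L0 finite_energyD(6)[OF density(1)] finite_energyD(6)[OF h]
        by (subst (asm) integral_nonneg_eq_0_iff_AE) auto
      then have "AE z in M. ennreal (g z) = ennreal (h z)" by eventually_elim simp
      then show ?thesis
        unfolding density(2) density_measure_def
        using finite_energyD(4)[OF density(1)] finite_energyD(4)[OF h] by (intro density_cong) auto
    next
      case infinite
      then show ?thesis using \<pi>(2) Fh by simp
    qed
  qed
  then show ?thesis using that h min by blast
qed

lemma optimal_cost_finite:
  obtains c0 where "optimal_cost \<mu> \<nu> C = ereal c0"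
proof -
  have "ereal (- k) \<le> transport_cost C \<pi>" if "\<pi> \<in> couplings \<mu> \<nu>" for \<pi>
  proof -
    interpret \<pi>: prob_space \<pi> using that by (simp add: couplings_def)
    have meas: "C \<in> borel_measurable \<pi>"
      using that C_borel by (simp add: couplings_def cong: measurable_cong_sets)
    show ?thesis
    proof (cases "integrable \<pi> C")
      case True
      have "- k \<le> (\<integral>z. C z \<partial>\<pi>)"
        by (rule \<pi>.integral_ge_const[OF True]) (simp add: C_ge)
      then show ?thesis by (simp add: transport_cost_def ext_integral_eq_integral[OF True])
    next
      case False
      have "ext_integral \<pi> C = \<infinity>"
        by (rule ext_integral_eq_infinity[OF meas _ _ False, of "\<lambda>_. - k"]) (auto simp: C_ge)
      then show ?thesis by (simp add: transport_cost_def)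
    qed
  qed
  then have low: "ereal (- k) \<le> optimal_cost \<mu> \<nu> C"
    unfolding optimal_cost_def by (rule INF_greatest)
  have "M = density_measure (\<lambda>_. 1)" by (simp add: density_measure_def density_1)
  then have "M \<in> couplings \<mu> \<nu>" using coupling_densitiesD(3)[OF one_coupling_density] by simp
  then have "optimal_cost \<mu> \<nu> C \<le> transport_cost C M"
    unfolding optimal_cost_def by (rule INF_lower)
  then have "optimal_cost \<mu> \<nu> C \<le> ereal (\<integral>z. C z \<partial>M)"
    by (simp add: transport_cost_def ext_integral_eq_integral C_integrable)
  with low show ?thesis using that by (cases "optimal_cost \<mu> \<nu> C") auto
qed

lemma d_BL_density_le_L1:
  fixes \<rho> :: "'a \<times> 'b \<Rightarrow> 'a \<times> 'b \<Rightarrow> real"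
  assumes "compatible_metric \<rho>" and g: "finite_energy g" and h: "finite_energy h"
  shows "d_BL \<rho> (density_measure g) (density_measure h) \<le> L1_dist g h"
proof -
  interpret \<rho>: compatible_metric \<rho> by fact
  note Dg = finite_energyD[OF g] and Dh = finite_energyD[OF h]
  show ?thesis
  proof (rule \<rho>.d_BL_least)
    fix f :: "'a \<times> 'b \<Rightarrow> real"
    assume f: "continuous_on UNIV f" "\<And>x. \<bar>f x\<bar> \<le> 1"
    have fM [measurable]: "f \<in> borel_measurable M"
      using borel_measurable_continuous_onI[OF f(1)] by (simp add: measurable_M_iff)
    have int: "integrable M (\<lambda>z. u z * f z)" if "finite_energy u" for u
    proof (rule Bochner_Integration.integrable_bound[OF finite_energyD(6)[OF that]])
      show "(\<lambda>z. u z * f z) \<in> borel_measurable M" using finite_energyD(4)[OF that] by measurable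
      show "AE z in M. norm (u z * f z) \<le> norm (u z)"
        by (rule AE_I2) (simp add: abs_mult mult_left_le f(2))
    qed
    have "(\<integral>z. f z \<partial>density_measure u) = (\<integral>z. u z * f z \<partial>M)" if "finite_energy u" for u
      unfolding density_measure_def
      by (rule integral_real_density) (use finite_energyD(4,5)[OF that] in auto)
    then have "(\<integral>z. f z \<partial>density_measure g) - (\<integral>z. f z \<partial>density_measure h)
        = (\<integral>z. g z * f z - h z * f z \<partial>M)"
      using int g h by simp
    also have "\<bar>\<dots>\<bar> \<le> L1_dist g h"
    proof (rule order_trans[OF integral_abs_bound], rule integral_mono)
      show "\<bar>g z * f z - h z * f z\<bar> \<le> \<bar>g z - h z\<bar>" for z
        using mult_left_mono[OF f(2), of "\<bar>g z - h z\<bar>" z]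
        by (simp add: left_diff_distrib flip: abs_mult)
    qed (use int[OF g] int[OF h] Dg(6) Dh(6) in auto)
    finally show "\<bar>(\<integral>z. f z \<partial>density_measure g) - (\<integral>z. f z \<partial>density_measure h)\<bar> \<le> L1_dist g h" .
  qed
qed

abbreviation gap :: "real \<Rightarrow> ('a \<times> 'b) measure \<Rightarrow> ereal" where
  "gap \<epsilon> \<pi> \<equiv> cost_gap \<mu> \<nu> C \<pi> + ereal \<epsilon> * coupling_entropy \<mu> \<nu> \<pi>"

text \<open>
  Quadratic growth in the bounded-Lipschitz distance. Test functions are bounded by \<open>1\<close>, so
  this distance is at most the \<open>L\<^sup>1\<close> distance of the densities; competitors of infinite cost
  satisfy the estimate trivially.
\<close>
proposition gap_quadratic_growth:
  fixes \<rho> :: "'a \<times> 'b \<Rightarrow> 'a \<times> 'b \<Rightarrow> real"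
  assumes \<rho>: "compatible_metric \<rho>" and \<epsilon>: "0 < \<epsilon>"
  obtains v where "entropic_plan \<mu> \<nu> C \<epsilon> \<in> couplings \<mu> \<nu>" "value_gap \<mu> \<nu> C \<epsilon> = ereal v"
    "gap \<epsilon> (entropic_plan \<mu> \<nu> C \<epsilon>) = ereal v"
    "\<And>\<pi>. \<pi> \<in> couplings \<mu> \<nu> \<Longrightarrow>
       ereal (v + \<epsilon> / 16 * (d_BL \<rho> \<pi> (entropic_plan \<mu> \<nu> C \<epsilon>))\<^sup>2) \<le> gap \<epsilon> \<pi>"
proof -
  interpret \<rho>: compatible_metric \<rho> by fact
  let ?p = "entropic_plan \<mu> \<nu> C \<epsilon>"
  obtain h where h: "finite_energy h" and p: "?p = density_measure h"
    and min: "\<And>g. finite_energy g \<Longrightarrow> energy \<epsilon> h + \<epsilon> / 16 * (L1_dist g h)\<^sup>2 \<le> energy \<epsilon> g"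
    by (rule entropic_plan_density[OF \<epsilon>]) blast
  obtain c0 where c0: "optimal_cost \<mu> \<nu> C = ereal c0" by (rule optimal_cost_finite)
  \<comment> \<open>The optimal cost is a real number, so it can be moved across the sum of extended reals.\<close>
  have gap_eq: "gap \<epsilon> \<pi> = entropic_cost \<mu> \<nu> C \<epsilon> \<pi> - ereal c0" for \<pi>
    unfolding cost_gap_def entropic_cost_def c0
    by (cases "transport_cost C \<pi>"; cases "ereal \<epsilon> * coupling_entropy \<mu> \<nu> \<pi>") auto
  have pc: "?p \<in> couplings \<mu> \<nu>"
    unfolding p using coupling_densitiesD(3) finite_energyD(1) h by blast
  have gp: "gap \<epsilon> ?p = ereal (energy \<epsilon> h - c0)"
    unfolding gap_eq p using entropic_cost_density[OF finite_energyD(1)[OF h] \<epsilon>] h by simp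
  have growth: "ereal (energy \<epsilon> h - c0 + \<epsilon> / 16 * (d_BL \<rho> \<pi> ?p)\<^sup>2) \<le> gap \<epsilon> \<pi>"
    if "\<pi> \<in> couplings \<mu> \<nu>" for \<pi>
    using that \<epsilon>
  proof (cases rule: coupling_entropic_cost_cases[case_names density infinite])
    case (density g)
    have "0 \<le> d_BL \<rho> \<pi> ?p"
      using that pc by (intro \<rho>.d_BL_nonneg) (auto simp: couplings_def)
    then have "(d_BL \<rho> \<pi> ?p)\<^sup>2 \<le> (L1_dist g h)\<^sup>2"
      using d_BL_density_le_L1[OF \<rho> density(1) h] unfolding density(2) p by (intro power_mono)
    then have "\<epsilon> / 16 * (d_BL \<rho> \<pi> ?p)\<^sup>2 \<le> \<epsilon> / 16 * (L1_dist g h)\<^sup>2"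
      using \<epsilon> by (intro mult_left_mono) auto
    then show ?thesis using min[OF density(1)] by (simp add: gap_eq density(3))
  qed (simp add: gap_eq)
  have "value_gap \<mu> \<nu> C \<epsilon> = ereal (energy \<epsilon> h - c0)"
    unfolding value_gap_def
  proof (rule antisym)
    show "(INF \<pi>\<in>couplings \<mu> \<nu>. gap \<epsilon> \<pi>) \<le> ereal (energy \<epsilon> h - c0)"
      using INF_lower[OF pc, of "gap \<epsilon>"] by (simp only: gp)
    show "ereal (energy \<epsilon> h - c0) \<le> (INF \<pi>\<in>couplings \<mu> \<nu>. gap \<epsilon> \<pi>)"
    proof (rule INF_greatest)
      fix \<pi> assume "\<pi> \<in> couplings \<mu> \<nu>"
      from growth[OF this] show "ereal (energy \<epsilon> h - c0) \<le> gap \<epsilon> \<pi>"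
        by (rule order_trans[rotated]) (use \<epsilon> in simp)
    qed
  qed
  then show ?thesis using that pc gp growth by blast
qed

end

section \<open>Characterisation of entropic limits\<close>

lemma frequently_at_right_0_obtain_decseq:
  fixes Q :: "nat \<Rightarrow> real \<Rightarrow> bool"
  assumes "\<And>n. \<exists>\<^sub>F \<epsilon> in at_right 0. Q n \<epsilon>"
  obtains e :: "nat \<Rightarrow> real" where "\<And>n. 0 < e n" "decseq e" "e \<longlonglongrightarrow> 0" "\<And>n. Q n (e n)"
proof -
  have pick: "\<exists>\<epsilon>. 0 < \<epsilon> \<and> \<epsilon> < d \<and> Q n \<epsilon>" if d: "0 < d" for d n
  proof -
    have "\<forall>\<^sub>F \<epsilon> in at_right 0. 0 < \<epsilon> \<and> \<epsilon> < d"
      using d by (auto simp: eventually_at_right_field)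
    from frequently_eventually_frequently[OF assms[of n] this] show ?thesis
      by (auto dest: frequently_ex)
  qed
  have "\<exists>e. \<forall>n. (0 < e n \<and> e n < 1 / real (Suc n) \<and> Q n (e n)) \<and> e (Suc n) \<le> e n"
  proof (rule dependent_nat_choice)
    show "\<exists>x. 0 < x \<and> x < 1 / real (Suc 0) \<and> Q 0 x" using pick[of 1 0] by simp
    fix x n assume "0 < x \<and> x < 1 / real (Suc n) \<and> Q n x"
    then show "\<exists>y. (0 < y \<and> y < 1 / real (Suc (Suc n)) \<and> Q (Suc n) y) \<and> y \<le> x"
      using pick[of "min x (1 / real (Suc (Suc n)))" "Suc n"] less_imp_le by fastforce
  qed
  then obtain e where e: "\<And>n. 0 < e n" "\<And>n. e n < 1 / real (Suc n)" "\<And>n. Q n (e n)"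
    "\<And>n. e (Suc n) \<le> e n" by blast
  have "e \<longlonglongrightarrow> 0"
    by (rule tendsto_sandwich[OF _ _ tendsto_const LIMSEQ_Suc[OF lim_1_over_n]];
        intro always_eventually allI less_imp_le e(1,2))
  then show ?thesis using that e(1,3,4) decseq_SucI by blast
qed

theorem theoremA1:
  fixes \<mu> :: "'a::polish_space measure"
    and \<nu> :: "'b::polish_space measure"
    and C :: "'a \<times> 'b \<Rightarrow> real"
    and \<rho> :: "'a \<times> 'b \<Rightarrow> 'a \<times> 'b \<Rightarrow> real"
    and \<pi>' :: "('a \<times> 'b) measure"
  assumes "prob_space \<mu>" and "sets \<mu> = sets borel"
    and "prob_space \<nu>" and "sets \<nu> = sets borel"
    and "continuous_on UNIV C" and "bdd_below (range C)" and "integrable (\<mu> \<Otimes>\<^sub>M \<nu>) C"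
    and "Metric_space UNIV \<rho>" and "Metric_space.mcomplete UNIV \<rho>"
    and "Metric_space.mtopology UNIV \<rho> = euclidean" and "\<And>z z'. \<rho> z z' \<le> 1"
    and "\<pi>' \<in> couplings \<mu> \<nu>"
  shows "(\<pi>' \<in> entropic_limits \<mu> \<nu> C \<longleftrightarrow>
            (\<forall>r>0. Liminf (at_right 0)
                (\<lambda>\<epsilon>. (value_gap_near \<rho> \<mu> \<nu> C \<pi>' r \<epsilon> - value_gap \<mu> \<nu> C \<epsilon>) / ereal \<epsilon>) = 0))
       \<and> (weak_conv_at (entropic_plan \<mu> \<nu> C) \<pi>' (at_right 0) \<longleftrightarrow>
            (\<forall>r>0. Liminf (at_right 0)
                (\<lambda>\<epsilon>. (value_gap_out \<rho> \<mu> \<nu> C \<pi>' r \<epsilon> - value_gap \<mu> \<nu> C \<epsilon>) / ereal \<epsilon>) > 0))"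
proof -
  obtain b where b: "\<And>z. b \<le> C z" using assms(6) unfolding bdd_below_def by blast
  interpret entropic_transport \<mu> \<nu> C "- b"
  proof (rule entropic_transport.intro)
    show "C \<in> borel_measurable borel" by (rule borel_measurable_continuous_onI[OF assms(5)])
    show "- (- b) \<le> C z" for z using b by simp
  qed (rule assms)+
  have \<rho>: "compatible_metric \<rho>"
    using assms(8,10) by (intro compatible_metric.intro compatible_metric_axioms.intro)
  interpret \<rho>: compatible_metric \<rho> by (rule \<rho>)
  let ?d = "d_BL \<rho>"
  define p where "p = entropic_plan \<mu> \<nu> C"
  let ?V = "value_gap \<mu> \<nu> C"
  let ?near = "\<lambda>r \<epsilon>. (value_gap_near \<rho> \<mu> \<nu> C \<pi>' r \<epsilon> - ?V \<epsilon>) / ereal \<epsilon>"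
  let ?out = "\<lambda>r \<epsilon>. (value_gap_out \<rho> \<mu> \<nu> C \<pi>' r \<epsilon> - ?V \<epsilon>) / ereal \<epsilon>"
  have prob: "borel_prob \<pi>" if "\<pi> \<in> couplings \<mu> \<nu>" for \<pi>
    using that by (simp add: couplings_def)
  have p: "p \<epsilon> \<in> couplings \<mu> \<nu>" if "0 < \<epsilon>" for \<epsilon>
    unfolding p_def by (rule gap_quadratic_growth[OF \<rho> that])
  have pos: "\<forall>\<^sub>F \<epsilon> in at_right 0. 0 < (\<epsilon> :: real)" by (rule eventually_at_right_less)
  \<comment> \<open>The two facts behind both equivalences: the scaled excess of a constrained problem is at
    least \<open>s\<^sup>2 / 16\<close> if the constraint set has distance at least \<open>s\<close> from \<open>p \<epsilon>\<close>, and
    it vanishes if \<open>p \<epsilon>\<close> is admissible.\<close>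
  have growth: "ereal (s\<^sup>2 / 16) \<le> ((INF \<pi>\<in>S. gap \<epsilon> \<pi>) - ?V \<epsilon>) / ereal \<epsilon>"
    if \<epsilon>: "0 < \<epsilon>" and S: "S \<subseteq> couplings \<mu> \<nu>" and s: "0 \<le> s" "\<And>\<pi>. \<pi> \<in> S \<Longrightarrow> s \<le> ?d \<pi> (p \<epsilon>)"
    for S \<epsilon> s
  proof -
    obtain v where v: "?V \<epsilon> = ereal v"
      and grow: "\<And>\<pi>. \<pi> \<in> couplings \<mu> \<nu> \<Longrightarrow> ereal (v + \<epsilon> / 16 * (?d \<pi> (p \<epsilon>))\<^sup>2) \<le> gap \<epsilon> \<pi>"
      unfolding p_def by (rule gap_quadratic_growth[OF \<rho> \<epsilon>]) blast
    have "ereal (v + \<epsilon> / 16 * s\<^sup>2) \<le> (INF \<pi>\<in>S. gap \<epsilon> \<pi>)"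
    proof (rule INF_greatest)
      fix \<pi> assume \<pi>: "\<pi> \<in> S"
      have "\<epsilon> / 16 * s\<^sup>2 \<le> \<epsilon> / 16 * (?d \<pi> (p \<epsilon>))\<^sup>2"
        using \<epsilon> s \<pi> by (intro mult_left_mono power_mono) auto
      then show "ereal (v + \<epsilon> / 16 * s\<^sup>2) \<le> gap \<epsilon> \<pi>"
        using grow[of \<pi>] \<pi> S by (intro order_trans[OF _ grow]) auto
    qed
    then show ?thesis
      using \<epsilon> by (cases "INF \<pi>\<in>S. gap \<epsilon> \<pi>") (simp_all add: v field_simps)
  qed
  have attained: "((INF \<pi>\<in>S. gap \<epsilon> \<pi>) - ?V \<epsilon>) / ereal \<epsilon> = 0"
    if \<epsilon>: "0 < \<epsilon>" and S: "S \<subseteq> couplings \<mu> \<nu>" "p \<epsilon> \<in> S" for S \<epsilon>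
  proof -
    obtain v where v: "?V \<epsilon> = ereal v" and gp: "gap \<epsilon> (p \<epsilon>) = ereal v"
      unfolding p_def by (rule gap_quadratic_growth[OF \<rho> \<epsilon>]) blast
    have "(INF \<pi>\<in>S. gap \<epsilon> \<pi>) = ?V \<epsilon>"
    proof (rule antisym)
      show "(INF \<pi>\<in>S. gap \<epsilon> \<pi>) \<le> ?V \<epsilon>"
        using INF_lower[OF S(2), of "gap \<epsilon>"] by (simp only: gp v)
      show "?V \<epsilon> \<le> (INF \<pi>\<in>S. gap \<epsilon> \<pi>)"
        unfolding value_gap_def by (rule INF_superset_mono[OF S(1)]) simp
    qed
    then show ?thesis by (simp add: v)
  qed
  have near_nonneg: "0 \<le> ?near r \<epsilon>" if "0 < \<epsilon>" for r \<epsilon>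
    unfolding value_gap_near_def
    using growth[of \<epsilon> "{\<pi> \<in> couplings \<mu> \<nu>. ?d \<pi> \<pi>' \<le> r}" 0] that p[OF that]
    by (auto simp: zero_ereal_def intro!: \<rho>.d_BL_nonneg prob)

  have part1: "\<pi>' \<in> entropic_limits \<mu> \<nu> C \<longleftrightarrow> (\<forall>r>0. Liminf (at_right 0) (?near r) = 0)"
  proof (intro iffI allI impI)
    fix r :: real assume r: "0 < r" and "\<pi>' \<in> entropic_limits \<mu> \<nu> C"
    then obtain e :: "nat \<Rightarrow> real" where e: "\<And>n. 0 < e n" "e \<longlonglongrightarrow> 0"
      and conv: "weak_conv_at (\<lambda>n. p (e n)) \<pi>' sequentially"
      by (auto simp: entropic_limits_def p_def)
    have "(\<lambda>n. ?d (p (e n)) \<pi>') \<longlonglongrightarrow> 0"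
      by (rule \<rho>.d_BL_tendsto_0_if_weak_conv_at[OF _ _ conv]) (use p[OF e(1)] prob assms(12) in auto)
    then have "\<forall>\<^sub>F n in sequentially. ?d (p (e n)) \<pi>' < r" by (rule order_tendstoD(2)) (rule r)
    then have zero: "\<forall>\<^sub>F n in sequentially. ?near r (e n) = 0"
    proof eventually_elim
      case (elim n)
      then show ?case
        unfolding value_gap_near_def by (intro attained e(1)) (use p[OF e(1)] in auto)
    qed
    have lim: "filterlim e (at_right 0) sequentially"
      using e by (intro tendsto_imp_filterlim_at_right always_eventually allI)
    have "\<not> 0 < Liminf (at_right 0) (?near r)"
    proof
      assume "0 < Liminf (at_right 0) (?near r)"
      then have "\<forall>\<^sub>F \<epsilon> in at_right 0. 0 < ?near r \<epsilon>" by (rule less_LiminfD)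
      then have "\<forall>\<^sub>F n in sequentially. 0 < ?near r (e n)"
        using lim by (rule eventually_compose_filterlim)
      with zero have "\<forall>\<^sub>F n in sequentially. False" by eventually_elim simp
      then show False by simp
    qed
    then have "Liminf (at_right 0) (?near r) \<le> 0" by (simp add: not_less)
    moreover have "0 \<le> Liminf (at_right 0) (?near r)"
      by (rule Liminf_bounded) (use pos near_nonneg in \<open>auto elim: eventually_mono\<close>)
    ultimately show "Liminf (at_right 0) (?near r) = 0" by (rule antisym)
  next
    assume L: "\<forall>r>0. Liminf (at_right 0) (?near r) = 0"
    \<comment> \<open>Otherwise the whole \<open>r\<close>-ball around \<open>\<pi>'\<close> has distance at least \<open>4 * r\<close> from
      \<open>p \<epsilon>\<close>, and the scaled excess is at least \<open>(4 * r)\<^sup>2 / 16 = r\<^sup>2\<close>.\<close>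
    have close: "?d (p \<epsilon>) \<pi>' \<le> 5 * r" if r: "0 < r" and \<epsilon>: "0 < \<epsilon>" "?near r \<epsilon> < ereal (r\<^sup>2)" for r \<epsilon>
    proof (rule ccontr)
      assume far: "\<not> ?d (p \<epsilon>) \<pi>' \<le> 5 * r"
      have "ereal ((4 * r)\<^sup>2 / 16) \<le> ?near r \<epsilon>"
        unfolding value_gap_near_def
      proof (rule growth[OF \<epsilon>(1)])
        fix \<pi> assume \<pi>: "\<pi> \<in> {\<pi> \<in> couplings \<mu> \<nu>. ?d \<pi> \<pi>' \<le> r}"
        have "?d (p \<epsilon>) \<pi>' \<le> ?d (p \<epsilon>) \<pi> + ?d \<pi> \<pi>'"
          by (intro \<rho>.d_BL_triangle prob p \<epsilon> assms(12)) (use \<pi> in auto)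
        then show "4 * r \<le> ?d \<pi> (p \<epsilon>)" using far \<pi> by (simp add: \<rho>.d_BL_commute)
      qed (use r in auto)
      then show False using \<epsilon>(2) by (simp add: power_mult_distrib)
    qed
    have freq: "\<exists>\<^sub>F \<epsilon> in at_right 0. 0 < \<epsilon> \<and> ?d (p \<epsilon>) \<pi>' \<le> 5 * (1 / real (Suc n))" for n
    proof -
      let ?r = "1 / real (Suc n)"
      have "\<exists>\<^sub>F \<epsilon> in at_right 0. ?near ?r \<epsilon> < ereal (?r\<^sup>2)"
      proof (rule ccontr)
        assume "\<not> (\<exists>\<^sub>F \<epsilon> in at_right 0. ?near ?r \<epsilon> < ereal (?r\<^sup>2))"
        then have "\<forall>\<^sub>F \<epsilon> in at_right 0. ereal (?r\<^sup>2) \<le> ?near ?r \<epsilon>"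
          by (simp add: not_frequently not_less)
        then have "ereal (?r\<^sup>2) \<le> Liminf (at_right 0) (?near ?r)" by (rule Liminf_bounded)
        moreover have "Liminf (at_right 0) (?near ?r) = 0" using L by simp
        ultimately show False by (simp add: zero_ereal_def)
      qed
      from frequently_eventually_frequently[OF this pos] show ?thesis
        by (rule frequently_elim1) (use close[of ?r] in auto)
    qed
    obtain e where e: "\<And>n. 0 < e n" "decseq e" "e \<longlonglongrightarrow> 0"
      and d: "\<And>n. 0 < e n \<and> ?d (p (e n)) \<pi>' \<le> 5 * (1 / real (Suc n))"
      using frequently_at_right_0_obtain_decseq[
          where Q = "\<lambda>n \<epsilon>. 0 < \<epsilon> \<and> ?d (p \<epsilon>) \<pi>' \<le> 5 * (1 / real (Suc n))", OF freq]
      by blast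
    have "(\<lambda>n. ?d (p (e n)) \<pi>') \<longlonglongrightarrow> 0"
    proof (rule tendsto_sandwich[OF _ _ tendsto_const])
      show "\<forall>\<^sub>F n in sequentially. 0 \<le> ?d (p (e n)) \<pi>'"
        by (intro always_eventually allI \<rho>.d_BL_nonneg prob p e assms(12))
      show "\<forall>\<^sub>F n in sequentially. ?d (p (e n)) \<pi>' \<le> 5 * (1 / real (Suc n))"
        using d by (intro always_eventually) blast
      show "(\<lambda>n. 5 * (1 / real (Suc n))) \<longlonglongrightarrow> 0"
        by (intro tendsto_mult_right_zero LIMSEQ_Suc[OF lim_1_over_n])
    qed
    then have "weak_conv_at (\<lambda>n. p (e n)) \<pi>' sequentially"
      by (intro \<rho>.weak_conv_at_if_d_BL_tendsto_0 always_eventually allI prob p e assms(12))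
    then show "\<pi>' \<in> entropic_limits \<mu> \<nu> C"
      using e assms(12) unfolding entropic_limits_def p_def by blast
  qed

  have prob_p: "\<forall>\<^sub>F \<epsilon> in at_right 0. borel_prob (p \<epsilon>)"
    using pos by eventually_elim (intro prob p)
  have part2: "weak_conv_at p \<pi>' (at_right 0) \<longleftrightarrow> (\<forall>r>0. 0 < Liminf (at_right 0) (?out r))"
  proof (intro iffI allI impI)
    fix r :: real assume r: "0 < r" and conv: "weak_conv_at p \<pi>' (at_right 0)"
    have "((\<lambda>\<epsilon>. ?d (p \<epsilon>) \<pi>') \<longlongrightarrow> 0) (at_right 0)"
      by (rule \<rho>.d_BL_tendsto_0_if_weak_conv_at[OF prob_p prob[OF assms(12)] conv])
    then have "\<forall>\<^sub>F \<epsilon> in at_right 0. ?d (p \<epsilon>) \<pi>' < r / 2"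
      by (rule order_tendstoD(2)) (use r in simp)
    \<comment> \<open>Couplings at distance at least \<open>r\<close> from \<open>\<pi>'\<close> stay \<open>r / 2\<close> away from \<open>p \<epsilon>\<close>.
      If there are none, the infimum is \<open>\<infinity>\<close> and the bound holds as well.\<close>
    with pos have "\<forall>\<^sub>F \<epsilon> in at_right 0. ereal ((r / 2)\<^sup>2 / 16) \<le> ?out r \<epsilon>"
    proof eventually_elim
      case (elim \<epsilon>)
      show ?case
        unfolding value_gap_out_def
      proof (rule growth[OF elim(1)])
        fix \<pi> assume \<pi>: "\<pi> \<in> {\<pi> \<in> couplings \<mu> \<nu>. r \<le> ?d \<pi> \<pi>'}"
        have "?d \<pi> \<pi>' \<le> ?d \<pi> (p \<epsilon>) + ?d (p \<epsilon>) \<pi>'"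
          by (intro \<rho>.d_BL_triangle prob p elim(1) assms(12)) (use \<pi> in auto)
        then show "r / 2 \<le> ?d \<pi> (p \<epsilon>)" using elim(2) \<pi> by simp
      qed (use r in auto)
    qed
    then have "ereal ((r / 2)\<^sup>2 / 16) \<le> Liminf (at_right 0) (?out r)" by (rule Liminf_bounded)
    moreover have "0 < ereal ((r / 2)\<^sup>2 / 16)" using r by simp
    ultimately show "0 < Liminf (at_right 0) (?out r)" by (rule order_less_le_trans[rotated])
  next
    assume L: "\<forall>r>0. 0 < Liminf (at_right 0) (?out r)"
    have "((\<lambda>\<epsilon>. ?d (p \<epsilon>) \<pi>') \<longlongrightarrow> 0) (at_right 0)"
    proof (rule tendstoI)
      fix r :: real assume r: "0 < r"
      then have "\<forall>\<^sub>F \<epsilon> in at_right 0. 0 < ?out r \<epsilon>" using L less_LiminfD by blast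
      with pos show "\<forall>\<^sub>F \<epsilon> in at_right 0. dist (?d (p \<epsilon>) \<pi>') 0 < r"
      proof eventually_elim
        case (elim \<epsilon>)
        have "?d (p \<epsilon>) \<pi>' < r"
        proof (rule ccontr)
          assume "\<not> ?d (p \<epsilon>) \<pi>' < r"
          then have "?out r \<epsilon> = 0"
            unfolding value_gap_out_def by (intro attained elim(1)) (use p[OF elim(1)] in auto)
          then show False using elim(2) by simp
        qed
        moreover have "0 \<le> ?d (p \<epsilon>) \<pi>'" by (intro \<rho>.d_BL_nonneg prob p elim(1) assms(12))
        ultimately show ?case by simp
      qed
    qed
    then show "weak_conv_at p \<pi>' (at_right 0)"
      by (rule \<rho>.weak_conv_at_if_d_BL_tendsto_0[OF prob_p prob[OF assms(12)]])
  qed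
  show ?thesis using part1 part2 unfolding p_def by blast
qed

end
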